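(* Let $n\ge2$, $p>1$, $R>0$, $B_R=\{x\in\mathbb{R}^n:|x|<R\}$, and $\Sigma=\left\{\delta\in(0,n):\ \delta\ne p\,\frac{n-1}{p-1}\right\}$. Then $$\lambda_{p,n}(B_R)\ \ge\ \Lambda^{(3)}_{p,n}(B_R)=\frac1{R^p}\sup_{\delta\in\Sigma}H(p,n,\delta),$$ where, with $z_+=z_+(p,n,\delta)$, $y_+=y_+(p,n,\delta)$, $z^0_-=z^0_-(p,n)$ as defined in the context, $$H(p,n,\delta)=\begin{cases}\left[\dfrac{p-\delta}{p(1-z_+)\,z_+^{\frac{\delta}{p-\delta}}}\right]^{p-1}\left[\dfrac{(p-\delta)z_+}{p(1-z_+)}+n-\delta\right],&0<\delta<p,\\[14pt] \left[\dfrac{p-1}{p\,e^{-z^0_-}z^0_-}\right]^{p-1}\left[\dfrac{p-1}{p\,e^{-z^0_-}z^0_-}+\dfrac{n-p}{e^{-z^0_-}}\right],&\delta=p,\\[14pt] \left[\dfrac{\delta-p}{p(1-y_+)\,y_+^{\frac{p}{\delta-p}}}\right]^{p-1}\left[\dfrac{\delta-p}{p(1-y_+)}+n-\delta\right],&p<\delta.\end{cases}$$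
   Context: $\lambda_{p,n}(\Omega)$ is the first eigenvalue of the $p$-Laplacian $\Delta_pu=\operatorname{div}(|\nabla u|^{p-2}\nabla u)$ in $\Omega\subset\mathbb{R}^n$ with zero Dirichlet boundary condition, i.e. $\lambda_{p,n}(\Omega)=\inf_{u\in W^{1,p}_0(\Omega)\setminus\{0\}}\int_\Omega|\nabla u|^pdx\big/\int_\Omega|u|^pdx$. Notation: $$A(p,n,\delta)=(p-1)[p-\delta-p(n-\delta)],\quad B(p,n,\delta)=(p-1)(n-\delta)(p+\delta)-(\delta-1)(p-\delta),$$ $$C(p,n,\delta)=-\delta(n-\delta)(p-1),\quad D=B^2-4AC,$$ $$A_0(p,n)=-p^2(n-p),\quad B_0(p,n)=p(p-1)(n-p-1),\quad C_0(p,n)=p(p-1),\quad D_0=B_0^2-4A_0C_0,$$ $$z_+(p,n,\delta)=\frac{-B+\sqrt D}{2A},\qquad y_+(p,n,\delta)=\frac{-B+\sqrt D}{2C},\qquad z^0_-(p,n)=\frac{-B_0-\sqrt{D_0}}{2A_0}.$$ (The cases $\delta=p$ and $p<\delta$ occur only when $p<n$, since $\delta<n$.) *)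

theory Defs
  imports "HOL-Analysis.Analysis"
begin

section \<open>Smooth compactly supported functions\<close>

definition partial_deriv :: "'n::finite \<Rightarrow> (real^'n \<Rightarrow> real) \<Rightarrow> real^'n \<Rightarrow> real" where
  "partial_deriv i f x = frechet_derivative f (at x) (axis i 1)"

definition grad :: "(real^'n::finite \<Rightarrow> real) \<Rightarrow> real^'n \<Rightarrow> real^'n" where
  "grad f x = (\<chi> i. partial_deriv i f x)"

primrec C_diff :: "nat \<Rightarrow> (real^'n::finite \<Rightarrow> real) \<Rightarrow> bool" where
  "C_diff 0 f \<longleftrightarrow> continuous_on UNIV f"
| "C_diff (Suc k) f \<longleftrightarrow> (\<forall>x. f differentiable (at x)) \<and> (\<forall>i. C_diff k (partial_deriv i f))"

text \<open>Elements of \<open>C\<^sub>c\<^sup>\<infinity>(\<Omega>)\<close>, extended by zero to the whole space.\<close>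

definition test_function :: "(real^'n::finite) set \<Rightarrow> (real^'n \<Rightarrow> real) \<Rightarrow> bool" where
  "test_function \<Omega> \<phi> \<longleftrightarrow> (\<forall>k. C_diff k \<phi>) \<and>
     compact (closure {x. \<phi> x \<noteq> 0}) \<and> closure {x. \<phi> x \<noteq> 0} \<subseteq> \<Omega>"


section \<open>Sobolev spaces and the first eigenvalue of the p-Laplacian\<close>

definition in_Lp :: "real \<Rightarrow> (real^'n::finite) set \<Rightarrow> (real^'n \<Rightarrow> 'b::euclidean_space) \<Rightarrow> bool" where
  "in_Lp p \<Omega> f \<longleftrightarrow> f \<in> borel_measurable (lebesgue_on \<Omega>) \<and>
     integrable (lebesgue_on \<Omega>) (\<lambda>x. norm (f x) powr p)"

text \<open>Used below for \<open>L\<^sup>p\<close> functions only, so that both integrals exist.\<close>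

definition has_weak_gradient ::
  "(real^'n::finite) set \<Rightarrow> (real^'n \<Rightarrow> real) \<Rightarrow> (real^'n \<Rightarrow> real^'n) \<Rightarrow> bool" where
  "has_weak_gradient \<Omega> u g \<longleftrightarrow> (\<forall>\<phi> i. test_function \<Omega> \<phi> \<longrightarrow>
     (LINT x|lebesgue_on \<Omega>. u x * partial_deriv i \<phi> x) = - (LINT x|lebesgue_on \<Omega>. (g x $ i) * \<phi> x))"

text \<open>The weak gradient is unique only up to null sets, so the spaces \<open>W\<^sup>1\<^sup>,\<^sup>p(\<Omega>)\<close> and
  \<open>W\<^sub>0\<^sup>1\<^sup>,\<^sup>p(\<Omega>)\<close> are given as relations between \<open>u\<close> and its weak gradient \<open>g\<close>.
  The latter is the closure of the test functions in the norm of \<open>W\<^sup>1\<^sup>,\<^sup>p(\<Omega>)\<close>.\<close>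

definition in_W1p ::
  "real \<Rightarrow> (real^'n::finite) set \<Rightarrow> (real^'n \<Rightarrow> real) \<Rightarrow> (real^'n \<Rightarrow> real^'n) \<Rightarrow> bool" where
  "in_W1p p \<Omega> u g \<longleftrightarrow> in_Lp p \<Omega> u \<and> in_Lp p \<Omega> g \<and> has_weak_gradient \<Omega> u g"

definition in_W01p ::
  "real \<Rightarrow> (real^'n::finite) set \<Rightarrow> (real^'n \<Rightarrow> real) \<Rightarrow> (real^'n \<Rightarrow> real^'n) \<Rightarrow> bool" where
  "in_W01p p \<Omega> u g \<longleftrightarrow> in_W1p p \<Omega> u g \<and>
     (\<exists>\<phi>. (\<forall>k. test_function \<Omega> (\<phi> k)) \<and>
        (\<lambda>k::nat. LINT x|lebesgue_on \<Omega>. \<bar>\<phi> k x - u x\<bar> powr p) \<longlonglongrightarrow> 0 \<and>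
        (\<lambda>k::nat. LINT x|lebesgue_on \<Omega>. norm (grad (\<phi> k) x - g x) powr p) \<longlonglongrightarrow> 0)"

text \<open>Infimum and (below) supremum are taken in the extended reals, so that no convention for
  unbounded or empty sets of reals enters.\<close>

definition lambda1 :: "real \<Rightarrow> (real^'n::finite) set \<Rightarrow> ereal" where
  "lambda1 p \<Omega> = Inf {ereal ((LINT x|lebesgue_on \<Omega>. norm (g x) powr p) /
                             (LINT x|lebesgue_on \<Omega>. \<bar>u x\<bar> powr p)) | u g.
                      in_W01p p \<Omega> u g \<and> \<not> (AE x in lebesgue_on \<Omega>. u x = 0)}"


section \<open>The explicit lower bound\<close>

definition A_coeff :: "real \<Rightarrow> real \<Rightarrow> real \<Rightarrow> real" where
  "A_coeff p n \<delta> = (p - 1) * (p - \<delta> - p * (n - \<delta>))"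

definition B_coeff :: "real \<Rightarrow> real \<Rightarrow> real \<Rightarrow> real" where
  "B_coeff p n \<delta> = (p - 1) * (n - \<delta>) * (p + \<delta>) - (\<delta> - 1) * (p - \<delta>)"

definition C_coeff :: "real \<Rightarrow> real \<Rightarrow> real \<Rightarrow> real" where
  "C_coeff p n \<delta> = - \<delta> * (n - \<delta>) * (p - 1)"

definition D_coeff :: "real \<Rightarrow> real \<Rightarrow> real \<Rightarrow> real" where
  "D_coeff p n \<delta> = (B_coeff p n \<delta>)\<^sup>2 - 4 * A_coeff p n \<delta> * C_coeff p n \<delta>"

definition A0_coeff :: "real \<Rightarrow> real \<Rightarrow> real" where
  "A0_coeff p n = - (p\<^sup>2) * (n - p)"

definition B0_coeff :: "real \<Rightarrow> real \<Rightarrow> real" where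
  "B0_coeff p n = p * (p - 1) * (n - p - 1)"

definition C0_coeff :: "real \<Rightarrow> real \<Rightarrow> real" where
  "C0_coeff p n = p * (p - 1)"

definition D0_coeff :: "real \<Rightarrow> real \<Rightarrow> real" where
  "D0_coeff p n = (B0_coeff p n)\<^sup>2 - 4 * A0_coeff p n * C0_coeff p n"

definition z_plus :: "real \<Rightarrow> real \<Rightarrow> real \<Rightarrow> real" where
  "z_plus p n \<delta> = (- B_coeff p n \<delta> + sqrt (D_coeff p n \<delta>)) / (2 * A_coeff p n \<delta>)"

definition y_plus :: "real \<Rightarrow> real \<Rightarrow> real \<Rightarrow> real" where
  "y_plus p n \<delta> = (- B_coeff p n \<delta> + sqrt (D_coeff p n \<delta>)) / (2 * C_coeff p n \<delta>)"

definition z0_minus :: "real \<Rightarrow> real \<Rightarrow> real" where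
  "z0_minus p n = (- B0_coeff p n - sqrt (D0_coeff p n)) / (2 * A0_coeff p n)"

definition H_fun :: "real \<Rightarrow> real \<Rightarrow> real \<Rightarrow> real" where
  "H_fun p n \<delta> =
    (if \<delta> < p then
       (let z = z_plus p n \<delta> in
         ((p - \<delta>) / (p * (1 - z) * z powr (\<delta> / (p - \<delta>)))) powr (p - 1) *
         ((p - \<delta>) * z / (p * (1 - z)) + n - \<delta>))
     else if \<delta> = p then
       (let z = z0_minus p n in
         ((p - 1) / (p * exp (- z) * z)) powr (p - 1) *
         ((p - 1) / (p * exp (- z) * z) + (n - p) / exp (- z)))
     else
       (let y = y_plus p n \<delta> in
         ((\<delta> - p) / (p * (1 - y) * y powr (p / (\<delta> - p)))) powr (p - 1) *
         ((\<delta> - p) / (p * (1 - y)) + n - \<delta>)))"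

definition Sigma_set :: "real \<Rightarrow> real \<Rightarrow> real set" where
  "Sigma_set p n = {\<delta>. 0 < \<delta> \<and> \<delta> < n \<and> \<delta> \<noteq> p * ((n - 1) / (p - 1))}"

definition Lambda3 :: "real \<Rightarrow> real \<Rightarrow> real \<Rightarrow> ereal" where
  "Lambda3 p n R = ereal (1 / R powr p) * (SUP \<delta>\<in>Sigma_set p n. ereal (H_fun p n \<delta>))"

end

theory Submission imports Defs begin

text \<open>
  For a radial field \<open>V(x) = v(|x|) x / |x|\<close> with \<open>v \<ge> 0\<close>, Young's inequality and the divergence theorem
  give \<open>\<integral> |\<nabla>u|\<^sup>p \<ge> \<integral> (div V - (p - 1) |V|\<^bsup>p/(p-1)\<^esup>) |u|\<^sup>p\<close>, so every lower bound of
  \<open>v' + (n - 1) v / r - (p - 1) v\<^bsup>p/(p-1)\<^esup>\<close> on \<open>(0, 1)\<close> bounds the first eigenvalue of the unit ball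
  from below. Only the radial derivative of \<open>u\<close> enters, so it suffices to treat each ray separately;
  the field may be singular at the origin because the boundary term there has the right sign.
  The choice \<open>v = -|w'|\<^bsup>p-2\<^esup>w' / w\<^bsup>p-1\<^esup>\<close> with \<open>w = (\<plusminus>(1 - r\<^bsup>k\<^esup>))\<^bsup>(p-1)/p\<^esup>\<close> and \<open>k = (p - \<delta>)/(p - 1)\<close>
  (with \<open>w = (- ln r)\<^bsup>(p-1)/p\<^esup>\<close> if \<open>\<delta> = p\<close>) makes this expression an explicit function of \<open>r\<close> whose
  critical points are the roots of a quadratic polynomial; its minimum is \<open>H(p, n, \<delta>)\<close>.
\<close>

section \<open>Polar coordinates\<close>

lemma nn_integral_lborel_scaleR:
  fixes F :: "'a::euclidean_space \<Rightarrow> ennreal"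
  assumes [measurable]: "F \<in> borel_measurable borel" and s: "s > 0"
  shows "(\<integral>\<^sup>+x. F x \<partial>lborel) = ennreal (s ^ DIM('a)) * (\<integral>\<^sup>+x. F (s *\<^sub>R x) \<partial>lborel)"
  by (subst lborel_affine[of s 0])
     (use s in \<open>auto simp: nn_integral_density nn_integral_distr nn_integral_cmult\<close>)

lemma nn_integral_inverse_Icc:
  assumes "0 < a" "a \<le> b"
  shows "(\<integral>\<^sup>+s. ennreal (1 / s) * indicator {a..b} s \<partial>lborel) = ennreal (ln b - ln a)"
  by (intro nn_integral_FTC_Icc) (use assms in \<open>auto intro!: derivative_eq_intros simp: field_simps\<close>)

text \<open>Averaging over the annulus \<open>1 \<le> |x| \<le> e\<close>, on each ray of which \<open>dr/r\<close> has mass one, replaces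
  the surface measure of the sphere.\<close>

lemma nn_integral_polar:
  fixes F :: "'a::euclidean_space \<Rightarrow> ennreal"
  assumes F[measurable]: "F \<in> borel_measurable borel"
  shows "(\<integral>\<^sup>+x. F x \<partial>lborel) =
    (\<integral>\<^sup>+x. indicator {x. 1 \<le> norm x \<and> norm x \<le> exp 1} x *
       (\<integral>\<^sup>+s. indicator {0<..} s * (ennreal (s ^ (DIM('a) - 1)) * F (s *\<^sub>R x)) \<partial>lborel) \<partial>lborel)"
    (is "_ = (\<integral>\<^sup>+x. indicator ?A x * _ x \<partial>lborel)")
proof -
  let ?n = "DIM('a)"
  have A[measurable]: "?A \<in> sets borel" by measurable
  \<comment> \<open>Rescaling x by s moves the dilation from \<open>F\<close> onto the annulus;
    dividing by the Jacobian s^n turns s^(n-1) into the density 1/s.\<close>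
  have ind: "indicator {0<..} s * (ennreal (s ^ (?n - 1)) *
        (\<integral>\<^sup>+x. indicator ?A x * F (s *\<^sub>R x) \<partial>lborel)) =
      indicator {0<..} s * (\<integral>\<^sup>+x. ennreal (1/s) * (indicator ?A (x /\<^sub>R s) * F x) \<partial>lborel)" for s
  proof (cases "s > 0")
    case True
    have "(\<integral>\<^sup>+x. ennreal (1/s) * (indicator ?A (x /\<^sub>R s) * F x) \<partial>lborel)
       = ennreal (1/s) * (ennreal (s ^ ?n) * (\<integral>\<^sup>+x. indicator ?A x * F (s *\<^sub>R x) \<partial>lborel))"
      by (subst nn_integral_cmult, measurable, subst nn_integral_lborel_scaleR[where s=s])
         (use True in auto)
    also have "ennreal (1/s) * (ennreal (s ^ ?n) * I) = ennreal (s ^ (?n - 1)) * I" for I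
    proof -
      have "1/s * s ^ ?n = s ^ (?n - 1)"
        using True by (simp add: power_diff)
      then show ?thesis using True by (simp flip: ennreal_mult mult.assoc)
    qed
    finally show ?thesis by simp
  qed auto
  have "(\<integral>\<^sup>+x. indicator ?A x *
       (\<integral>\<^sup>+s. indicator {0<..} s * (ennreal (s ^ (?n - 1)) * F (s *\<^sub>R x)) \<partial>lborel) \<partial>lborel)
     = (\<integral>\<^sup>+x. (\<integral>\<^sup>+s. indicator {0<..} s * (ennreal (s ^ (?n - 1)) * (indicator ?A x * F (s *\<^sub>R x))) \<partial>lborel) \<partial>lborel)"
    by (intro nn_integral_cong, subst nn_integral_cmult[symmetric]) (auto simp: algebra_simps)
  also have "\<dots> = (\<integral>\<^sup>+s. (\<integral>\<^sup>+x. indicator {0<..} s * (ennreal (s ^ (?n - 1)) * (indicator ?A x * F (s *\<^sub>R x))) \<partial>lborel) \<partial>lborel)"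
    by (rule lborel_pair.Fubini') measurable
  also have "\<dots> = (\<integral>\<^sup>+s. indicator {0<..} s * (ennreal (s ^ (?n - 1)) *
        (\<integral>\<^sup>+x. indicator ?A x * F (s *\<^sub>R x) \<partial>lborel)) \<partial>lborel)"
    by (intro nn_integral_cong) (simp add: nn_integral_cmult)
  also have "\<dots> = (\<integral>\<^sup>+s. (\<integral>\<^sup>+x. indicator {0<..} s * (ennreal (1/s) * (indicator ?A (x /\<^sub>R s) * F x)) \<partial>lborel) \<partial>lborel)"
    unfolding ind by (intro nn_integral_cong) (simp add: nn_integral_cmult)
  also have "\<dots> = (\<integral>\<^sup>+x. (\<integral>\<^sup>+s. indicator {0<..} s * (ennreal (1/s) * (indicator ?A (x /\<^sub>R s) * F x)) \<partial>lborel) \<partial>lborel)"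
    by (rule lborel_pair.Fubini') measurable
  also have "\<dots> = (\<integral>\<^sup>+x. F x \<partial>lborel)"
  proof (rule nn_integral_cong_AE)
    \<comment> \<open>The origin is a null set. For any other x, the point x/s lies in the annulus
      exactly when s is between |x|/e and |x|, an interval of mass ln e = 1 for ds/s.\<close>
    have "AE x in lborel. x \<noteq> (0::'a)" by (rule AE_lborel_singleton)
    then show "AE x in lborel. (\<integral>\<^sup>+s. indicator {0<..} s * (ennreal (1/s) * (indicator ?A (x /\<^sub>R s) * F x)) \<partial>lborel) = F x"
    proof eventually_elim
      case (elim x)
      define r where "r = norm x"
      have r: "r > 0" using elim by (simp add: r_def)
      have "(\<integral>\<^sup>+s. indicator {0<..} s * (ennreal (1/s) * (indicator ?A (x /\<^sub>R s) * F x)) \<partial>lborel)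
        = (\<integral>\<^sup>+s. F x * (ennreal (1/s) * indicator {r / exp 1..r} s) \<partial>lborel)"
      proof (rule nn_integral_cong, cases)
        fix s :: real assume s: "s > 0"
        have "x /\<^sub>R s \<in> ?A \<longleftrightarrow> s \<in> {r / exp 1..r}"
          using s by (auto simp: r_def field_simps)
        then have i: "indicator ?A (x /\<^sub>R s) = (indicator {r / exp 1..r} s :: ennreal)"
          by (auto simp: indicator_def)
        show "indicator {0<..} s * (ennreal (1/s) * (indicator ?A (x /\<^sub>R s) * F x)) =
          F x * (ennreal (1/s) * indicator {r / exp 1..r} s)"
          unfolding i using s by (simp add: algebra_simps)
      next
        fix s :: real assume s: "\<not> s > 0"
        have "s \<notin> {r / exp 1..r}"
          using s r by (auto simp: not_le intro: less_le_trans) (smt (verit) divide_pos_pos exp_gt_zero)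
        then show "indicator {0<..} s * (ennreal (1/s) * (indicator ?A (x /\<^sub>R s) * F x)) =
          F x * (ennreal (1/s) * indicator {r / exp 1..r} s)" using s by simp
      qed
      also have "\<dots> = F x * ennreal (ln r - ln (r / exp 1))"
        using r by (subst nn_integral_cmult, measurable, subst nn_integral_inverse_Icc) (auto simp: field_simps)
      also have "\<dots> = F x" using r by (simp add: ln_div)
      finally show ?case .
    qed
  qed
  finally show ?thesis by simp
qed

section \<open>The inequality on a ray\<close>

text \<open>The delicate point is the origin: there the difference quotient has size |h|^(p-1),
  which tends to 0 because \<open>p > 1\<close>, in agreement with \<open>sgn 0 = 0\<close>.\<close>

lemma DERIV_abs_powr:
  assumes "p > (1::real)"
  shows "((\<lambda>t. \<bar>t\<bar> powr p) has_real_derivative p * \<bar>x\<bar> powr (p - 1) * sgn x) (at x)"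
proof (cases "x = 0")
  case True
  have "((\<lambda>h. \<bar>h\<bar> powr (p - 1)) \<longlongrightarrow> 0) (at (0::real))"
  proof -
    have "((\<lambda>h::real. \<bar>h\<bar> powr (p - 1)) \<longlongrightarrow> \<bar>0\<bar> powr (p - 1)) (at 0)"
      using assms by (intro tendsto_powr2 tendsto_intros) auto
    then show ?thesis by simp
  qed
  then have "((\<lambda>h. (\<bar>h\<bar> powr p) / h) \<longlongrightarrow> 0) (at (0::real))"
  proof (rule tendsto_0_le[where K=1])
    show "\<forall>\<^sub>F h::real in at 0. norm ((\<bar>h\<bar> powr p) / h) \<le> norm (\<bar>h\<bar> powr (p - 1)) * 1"
      by (rule always_eventually) (auto simp: powr_diff)
  qed
  then show ?thesis using True by (simp add: DERIV_def)
next
  case False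
  then consider "x > 0" | "x < 0" by linarith
  then show ?thesis
  proof cases
    case 1
    have "((\<lambda>t. t powr p) has_real_derivative p * \<bar>x\<bar> powr (p - 1) * sgn x) (at x)"
      using 1 by (auto intro!: derivative_eq_intros)
    moreover have "\<forall>\<^sub>F t in nhds x. \<bar>t\<bar> powr p = t powr p"
      using eventually_nhds_in_open[of "{0<..}" x] 1 by (auto elim!: eventually_mono)
    ultimately show ?thesis by (simp add: DERIV_cong_ev[OF refl _ refl])
  next
    case 2
    have "((\<lambda>t. (-t) powr p) has_real_derivative p * \<bar>x\<bar> powr (p - 1) * sgn x) (at x)"
      using 2 by (auto intro!: derivative_eq_intros)
    moreover have "\<forall>\<^sub>F t in nhds x. \<bar>t\<bar> powr p = (-t) powr p"
      using eventually_nhds_in_open[of "{..<0}" x] 2 by (auto elim!: eventually_mono)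
    ultimately show ?thesis by (simp add: DERIV_cong_ev[OF refl _ refl])
  qed
qed

text \<open>Young's inequality with exponents p and p/(p-1) for the factors \<open>c\<close> and v
  a^(p-1), multiplied by p. With a = |f| and c = |f'| it absorbs the term that arises from
  differentiating |f|^p.\<close>

lemma Young_powr:
  fixes a c v p :: real
  assumes "p > 1" "a \<ge> 0" "c \<ge> 0" "v \<ge> 0"
  shows "p * v * a powr (p - 1) * c \<le> c powr p + (p - 1) * v powr (p / (p - 1)) * a powr p"
proof -
  have "c * (v * a powr (p - 1)) \<le> c powr p / p + (v * a powr (p - 1)) powr (p / (p - 1)) / (p / (p - 1))"
    using assms by (intro Youngs_inequality) (auto simp: field_simps)
  also have "(v * a powr (p - 1)) powr (p / (p - 1)) = v powr (p / (p - 1)) * a powr p"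
    using assms by (simp add: powr_mult powr_powr)
  finally have "p * (c * (v * a powr (p - 1))) \<le> p * (c powr p / p + v powr (p / (p - 1)) * a powr p / (p / (p - 1)))"
    using assms by simp
  also have "\<dots> = c powr p + (p - 1) * v powr (p / (p - 1)) * a powr p"
    using assms by (simp add: field_simps)
  finally show ?thesis by (simp add: algebra_simps)
qed

text \<open>The integrand is at most the derivative of \<open>s\<^bsup>n-1\<^esup> v |f|\<^sup>p\<close>, which is nonnegative at the lower end of
  \<open>[\<epsilon>, b]\<close> and vanishes at the upper one.\<close>

lemma ray_inequality:
  fixes f f' v v' :: "real \<Rightarrow> real" and p h b :: real and n :: nat
  assumes p: "p > 1" and b: "b > 0" and n: "n \<ge> 1"
    and f: "\<And>s. (f has_real_derivative f' s) (at s)" and f'[continuous_intros]: "continuous_on UNIV f'"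
    and fb: "f b = 0"
    and v0: "\<And>s. 0 < s \<Longrightarrow> s \<le> b \<Longrightarrow> v s \<ge> 0"
    and v: "\<And>s. 0 < s \<Longrightarrow> s \<le> b \<Longrightarrow> (v has_real_derivative v' s) (at s)"
    and ineq: "\<And>s. 0 < s \<Longrightarrow> s \<le> b \<Longrightarrow>
       v' s + real (n - 1) / s * v s - (p - 1) * v s powr (p / (p - 1)) \<ge> h"
  shows "integral {0..b} (\<lambda>s. s ^ (n - 1) * (h * \<bar>f s\<bar> powr p - \<bar>f' s\<bar> powr p)) \<le> 0"
proof -
  define G where "G s = s ^ (n - 1) * (h * \<bar>f s\<bar> powr p - \<bar>f' s\<bar> powr p)" for s
  have cf[continuous_intros]: "continuous_on UNIV f"
    using f by (meson DERIV_isCont continuous_at_imp_continuous_on)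
  have cG: "continuous_on S G" for S
    unfolding G_def by (rule continuous_on_subset[of UNIV]) (use p in \<open>auto intro!: continuous_intros continuous_on_powr'\<close>)
  \<comment> \<open>Nothing controls \<open>v\<close> at 0, so the fundamental theorem of calculus
    is applied on intervals that stay away from 0.\<close>
  have eps: "integral {\<epsilon>..b} G \<le> 0" if \<epsilon>: "0 < \<epsilon>" "\<epsilon> \<le> b" for \<epsilon>
  proof -
    define W where "W s = s ^ (n - 1) * v s * \<bar>f s\<bar> powr p" for s
    define W' where "W' s = (real (n - 1) * s ^ (n - 1 - 1) * v s + s ^ (n - 1) * v' s) * \<bar>f s\<bar> powr p
         + s ^ (n - 1) * v s * (p * \<bar>f s\<bar> powr (p - 1) * sgn (f s) * f' s)" for s
    have dW: "(W has_real_derivative W' s) (at s)" if "0 < s" "s \<le> b" for s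
    proof -
      have D1: "((\<lambda>s. \<bar>f s\<bar> powr p) has_real_derivative p * \<bar>f s\<bar> powr (p - 1) * sgn (f s) * f' s) (at s)"
        using DERIV_chain[OF DERIV_abs_powr[OF p] f, of s] by (simp add: o_def)
      have D2: "((\<lambda>s. s ^ (n - 1) * v s) has_real_derivative
          real (n - 1) * s ^ (n - 1 - 1) * v s + v' s * s ^ (n - 1)) (at s)"
        using DERIV_mult[OF DERIV_pow[of "n - 1"] v[OF that]] by simp
      have "(W has_real_derivative
          (real (n - 1) * s ^ (n - 1 - 1) * v s + v' s * s ^ (n - 1)) * \<bar>f s\<bar> powr p
         + (p * \<bar>f s\<bar> powr (p - 1) * sgn (f s) * f' s) * (s ^ (n - 1) * v s)) (at s)"
        unfolding W_def by (rule DERIV_mult[OF D2 D1])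
      then show ?thesis by (simp add: W'_def algebra_simps)
    qed
    have IW: "(W' has_integral (W b - W \<epsilon>)) {\<epsilon>..b}"
    proof (rule fundamental_theorem_of_calculus[OF \<epsilon>(2)])
      fix s assume "s \<in> {\<epsilon>..b}"
      then have "(W has_real_derivative W' s) (at s)" using \<epsilon> dW by simp
      then show "(W has_vector_derivative W' s) (at s within {\<epsilon>..b})"
        by (simp add: has_field_derivative_at_within flip: has_real_derivative_iff_has_vector_derivative)
    qed
    have IG: "(G has_integral integral {\<epsilon>..b} G) {\<epsilon>..b}"
      by (intro integrable_integral integrable_continuous_interval cG)
    have le: "G s \<le> W' s" if s: "s \<in> {\<epsilon>..b}" for s
    proof -
      have s0: "0 < s" "s \<le> b" using s \<epsilon> by auto
      \<comment> \<open>For \<open>n = 1\<close> the truncated exponent \<open>n - 1 - 1\<close>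
        does no harm, since the factor \<open>n - 1\<close> is then 0.\<close>
      have pw: "real (n - 1) * s ^ (n - 1 - 1) = s ^ (n - 1) * (real (n - 1) / s)"
        using s0 by (cases "n - 1") auto
      have "- (f' s * sgn (f s)) \<le> \<bar>f' s\<bar>"
        by (auto simp: sgn_if)
      then have "p * v s * \<bar>f s\<bar> powr (p - 1) * (- (f' s * sgn (f s))) \<le> p * v s * \<bar>f s\<bar> powr (p - 1) * \<bar>f' s\<bar>"
        using v0[OF s0] p by (intro mult_left_mono) auto
      also have "\<dots> \<le> \<bar>f' s\<bar> powr p + (p - 1) * v s powr (p / (p - 1)) * \<bar>f s\<bar> powr p"
        by (rule Young_powr) (use p v0[OF s0] in auto)
      finally have Y: "- (p * v s * \<bar>f s\<bar> powr (p - 1) * (f' s * sgn (f s))) \<le> \<bar>f' s\<bar> powr p + (p - 1) * v s powr (p / (p - 1)) * \<bar>f s\<bar> powr p"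
        by simp
      have "h * \<bar>f s\<bar> powr p \<le> (v' s + real (n - 1) / s * v s - (p - 1) * v s powr (p / (p - 1))) * \<bar>f s\<bar> powr p"
        by (intro mult_right_mono ineq s0) auto
      then have "h * \<bar>f s\<bar> powr p - \<bar>f' s\<bar> powr p \<le>
           (v' s + real (n - 1) / s * v s) * \<bar>f s\<bar> powr p + p * v s * \<bar>f s\<bar> powr (p - 1) * (f' s * sgn (f s))"
        using Y by (simp add: algebra_simps)
      then have "G s \<le> s ^ (n - 1) * ((v' s + real (n - 1) / s * v s) * \<bar>f s\<bar> powr p + p * v s * \<bar>f s\<bar> powr (p - 1) * (f' s * sgn (f s)))"
        unfolding G_def using s0 by (intro mult_left_mono) auto
      also have "\<dots> = W' s"
        unfolding W'_def pw by (simp add: algebra_simps)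
      finally show ?thesis .
    qed
    have "integral {\<epsilon>..b} G \<le> W b - W \<epsilon>"
      by (rule has_integral_le[OF IG IW le])
    also have "\<dots> \<le> 0"
      using fb v0[of \<epsilon>] \<epsilon> by (auto simp: W_def)
    finally show ?thesis .
  qed
  \<comment> \<open>Dropping the nonpositive integral over [x, b] bounds the whole integral by the
    one over [0, x], which tends to 0 with x because \<open>G\<close> is continuous up to 0.\<close>
  have "continuous_on {0..b} (\<lambda>x. integral {0..x} G)"
    by (intro indefinite_integral_continuous_1 integrable_continuous_interval cG)
  then have "((\<lambda>x. integral {0..x} G) \<longlongrightarrow> integral {0..0} G) (at_right 0)"
    using b by (metis at_within_Icc_at_right atLeastAtMost_iff continuous_on le_less)
  moreover have "\<forall>\<^sub>F x in at_right 0. integral {0..b} G \<le> integral {0..x} G"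
    using eventually_at_right_real[OF b]
  proof eventually_elim
    case (elim x)
    have "integral {0..x} G + integral {x..b} G = integral {0..b} G"
      using elim by (intro Henstock_Kurzweil_Integration.integral_combine integrable_continuous_interval cG) auto
    then show ?case using eps[of x] elim by auto
  qed
  ultimately have "integral {0..b} G \<le> integral {0..0} G"
    by (intro tendsto_lowerbound) auto
  then show ?thesis unfolding G_def by simp
qed

section \<open>Passage from test functions to the Sobolev space\<close>

text \<open>Convexity of the p-th power, applied to a + b = (1 - t)(a/(1 - t)) + t(b/t). The weight
  t is left free: as t tends to 0 the factor at the main term \<open>a\<close> tends to 1, while the
  large factor at \<open>b\<close> will only meet an error that can be made small first. This takes
  the place of Minkowski's inequality.\<close>

lemma norm_add_powr_le:
  fixes a b :: "'b::real_normed_vector"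
  assumes p: "p > 1" and t: "0 < t" "t < 1"
  shows "norm (a + b) powr p \<le> (1 - t) powr (1 - p) * norm a powr p + t powr (1 - p) * norm b powr p"
proof -
  have ge1: "1 \<le> s powr (1 - p)" if "0 < s" "s < 1" for s
  proof -
    have "(1 - p) * ln s \<ge> 0" using that p by (simp add: mult_nonpos_nonpos)
    then show ?thesis using that by (simp add: powr_def)
  qed
  consider "a = 0" | "b = 0" | "a \<noteq> 0" "b \<noteq> 0" by blast
  then show ?thesis
  proof cases
    case 1
    then show ?thesis using mult_right_mono[OF ge1[OF t], of "norm b powr p"] by simp
  next
    case 2
    then show ?thesis using mult_right_mono[OF ge1[of "1 - t"], of "norm a powr p"] t by simp
  next
    case 3
    have "norm (a + b) powr p \<le> ((1 - t) * (norm a / (1 - t)) + t * (norm b / t)) powr p"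
      using t p norm_triangle_ineq[of a b] by (intro powr_mono2) auto
    also have "\<dots> \<le> (1 - t) * (norm a / (1 - t)) powr p + t * (norm b / t) powr p"
      using convex_onD[OF powr_convex, of p t "norm a / (1 - t)" "norm b / t"] p t 3 by simp
    also have "\<dots> = (1 - t) powr (1 - p) * norm a powr p + t powr (1 - p) * norm b powr p"
      using t by (simp add: powr_divide powr_diff)
    finally show ?thesis .
  qed
qed

lemma
  fixes a b :: "real^'n::finite \<Rightarrow> 'b::euclidean_space"
  assumes p: "p > 1" and a: "in_Lp p \<Omega> a" and b: "in_Lp p \<Omega> b"
  shows in_Lp_add: "in_Lp p \<Omega> (\<lambda>x. a x + b x)"
    and LINT_norm_add_powr_le: "0 < t \<Longrightarrow> t < 1 \<Longrightarrow>
      (LINT x|lebesgue_on \<Omega>. norm (a x + b x) powr p) \<le>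
        (1 - t) powr (1 - p) * (LINT x|lebesgue_on \<Omega>. norm (a x) powr p) +
        t powr (1 - p) * (LINT x|lebesgue_on \<Omega>. norm (b x) powr p)"
proof -
  have [measurable]: "a \<in> borel_measurable (lebesgue_on \<Omega>)" "b \<in> borel_measurable (lebesgue_on \<Omega>)"
    and int: "integrable (lebesgue_on \<Omega>) (\<lambda>x. norm (a x) powr p)" "integrable (lebesgue_on \<Omega>) (\<lambda>x. norm (b x) powr p)"
    using a b by (auto simp: in_Lp_def)
  have dom: "integrable (lebesgue_on \<Omega>) (\<lambda>x. (1 - t) powr (1 - p) * norm (a x) powr p + t powr (1 - p) * norm (b x) powr p)" for t
    using int by auto
  have ab: "integrable (lebesgue_on \<Omega>) (\<lambda>x. norm (a x + b x) powr p)"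
    by (rule Bochner_Integration.integrable_bound[OF dom[of "1/2"]])
       (use norm_add_powr_le[OF p, of "1/2"] in \<open>auto intro!: AE_I2\<close>)
  then show "in_Lp p \<Omega> (\<lambda>x. a x + b x)" by (simp add: in_Lp_def)
  assume t: "0 < t" "t < 1"
  have "(LINT x|lebesgue_on \<Omega>. norm (a x + b x) powr p) \<le>
      (LINT x|lebesgue_on \<Omega>. (1 - t) powr (1 - p) * norm (a x) powr p + t powr (1 - p) * norm (b x) powr p)"
    by (intro integral_mono ab dom norm_add_powr_le p t)
  also have "\<dots> = (1 - t) powr (1 - p) * (LINT x|lebesgue_on \<Omega>. norm (a x) powr p) +
        t powr (1 - p) * (LINT x|lebesgue_on \<Omega>. norm (b x) powr p)"
    using int by (subst Bochner_Integration.integral_add) auto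
  finally show "(LINT x|lebesgue_on \<Omega>. norm (a x + b x) powr p) \<le>
        (1 - t) powr (1 - p) * (LINT x|lebesgue_on \<Omega>. norm (a x) powr p) +
        t powr (1 - p) * (LINT x|lebesgue_on \<Omega>. norm (b x) powr p)" .
qed

lemma in_Lp_uminus: "in_Lp p \<Omega> a \<Longrightarrow> in_Lp p \<Omega> (\<lambda>x. - a x)"
  by (simp add: in_Lp_def)

text \<open>Both p-th power integrals pass to the limit along an approximating sequence of test
  functions, so an inequality for test functions extends to the whole closure, and division by the
  integral of |u|^p gives the bound on the quotient.\<close>

lemma lambda1_ge:
  fixes \<Omega> :: "(real^'n::finite) set"
  assumes p: "p > 1" and h: "h \<ge> 0"
    and Lp: "\<And>\<phi>. test_function \<Omega> \<phi> \<Longrightarrow> in_Lp p \<Omega> \<phi> \<and> in_Lp p \<Omega> (grad \<phi>)"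
    and ineq: "\<And>\<phi>. test_function \<Omega> \<phi> \<Longrightarrow>
      h * (LINT x|lebesgue_on \<Omega>. \<bar>\<phi> x\<bar> powr p) \<le> (LINT x|lebesgue_on \<Omega>. norm (grad \<phi> x) powr p)"
  shows "ereal h \<le> lambda1 p \<Omega>"
  unfolding lambda1_def
proof (rule Inf_greatest, clarify)
  fix u :: "real^'n \<Rightarrow> real" and g
  assume W: "in_W01p p \<Omega> u g" and nz: "\<not> (AE x in lebesgue_on \<Omega>. u x = 0)"
  define U where "U = (LINT x|lebesgue_on \<Omega>. \<bar>u x\<bar> powr p)"
  define I where "I = (LINT x|lebesgue_on \<Omega>. norm (g x) powr p)"
  from W have u: "in_Lp p \<Omega> u" and g: "in_Lp p \<Omega> g" by (auto simp: in_W01p_def in_W1p_def)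
  from W obtain \<phi> where test: "\<And>k::nat. test_function \<Omega> (\<phi> k)"
    and lim: "(\<lambda>k. LINT x|lebesgue_on \<Omega>. \<bar>\<phi> k x - u x\<bar> powr p) \<longlonglongrightarrow> 0"
     "(\<lambda>k. LINT x|lebesgue_on \<Omega>. norm (grad (\<phi> k) x - g x) powr p) \<longlonglongrightarrow> 0"
    by (auto simp: in_W01p_def)
  \<comment> \<open>The splittings are u = phi_k + (u - phi_k) and grad phi_k = g + (grad phi_k -
    g). For fixed t the errors vanish as k grows; letting t tend to 0 afterwards removes the
    remaining factors.\<close>
  have step: "h * U \<le> (1 - t) powr (1 - p) * ((1 - t) powr (1 - p) * I)" if t: "0 < t" "t < 1" for t
  proof -
    define c d where "c = (1 - t) powr (1 - p)" and "d = t powr (1 - p)"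
    define e e' where "e k = (LINT x|lebesgue_on \<Omega>. \<bar>\<phi> k x - u x\<bar> powr p)"
      and "e' k = (LINT x|lebesgue_on \<Omega>. norm (grad (\<phi> k) x - g x) powr p)" for k
    have le: "h * U \<le> c * (c * I + d * e' k) + h * (d * e k)" for k
    proof -
      note L = Lp[OF test[of k]]
      have diff: "in_Lp p \<Omega> (\<lambda>x. u x - \<phi> k x)" "in_Lp p \<Omega> (\<lambda>x. grad (\<phi> k) x - g x)"
        using in_Lp_add[OF p u in_Lp_uminus] in_Lp_add[OF p _ in_Lp_uminus[OF g]] L by auto
      have "U \<le> c * (LINT x|lebesgue_on \<Omega>. \<bar>\<phi> k x\<bar> powr p) + d * e k"
        using LINT_norm_add_powr_le[OF p L[THEN conjunct1] diff(1) t]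
        by (simp add: U_def c_def d_def e_def abs_minus_commute)
      then have "h * U \<le> h * (c * (LINT x|lebesgue_on \<Omega>. \<bar>\<phi> k x\<bar> powr p) + d * e k)"
        using h by (rule mult_left_mono)
      also have "\<dots> = c * (h * (LINT x|lebesgue_on \<Omega>. \<bar>\<phi> k x\<bar> powr p)) + h * (d * e k)"
        by (simp add: algebra_simps)
      also have "h * (LINT x|lebesgue_on \<Omega>. \<bar>\<phi> k x\<bar> powr p) \<le> (LINT x|lebesgue_on \<Omega>. norm (grad (\<phi> k) x) powr p)"
        by (rule ineq[OF test])
      also have "\<dots> \<le> c * I + d * e' k"
        using LINT_norm_add_powr_le[OF p g diff(2) t] by (simp add: I_def c_def d_def e'_def)
      finally show ?thesis by (simp add: c_def mult_left_mono)
    qed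
    have "(\<lambda>k. c * (c * I + d * e' k) + h * (d * e k)) \<longlonglongrightarrow> c * (c * I + d * 0) + h * (d * 0)"
      unfolding e_def e'_def by (intro tendsto_intros lim)
    then show ?thesis
      using le by (intro LIMSEQ_le_const[where X="\<lambda>k. c * (c * I + d * e' k) + h * (d * e k)"]) (auto simp: c_def)
  qed
  have "((\<lambda>t. (1 - t) powr (1 - p) * ((1 - t) powr (1 - p) * I)) \<longlongrightarrow> (1 - 0) powr (1 - p) * ((1 - 0) powr (1 - p) * I)) (at_right 0)"
    by (intro tendsto_intros) auto
  moreover have "\<forall>\<^sub>F t in at_right 0. h * U \<le> (1 - t) powr (1 - p) * ((1 - t) powr (1 - p) * I)"
    using eventually_at_right_real[OF zero_less_one] by eventually_elim (use step in auto)
  ultimately have "h * U \<le> I"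
    by (intro tendsto_lowerbound[where F="at_right (0::real)"]) auto
  \<comment> \<open>Integrability of |u|^p rules out that the integral is 0 merely by the default
    value of the Bochner integral, so \<open>U = 0\<close> would force u = 0 almost
    everywhere.\<close>
  moreover have "U > 0"
  proof -
    have "integrable (lebesgue_on \<Omega>) (\<lambda>x. \<bar>u x\<bar> powr p)" using u by (simp add: in_Lp_def)
    then have "U \<noteq> 0"
      using nz unfolding U_def by (subst integral_nonneg_eq_0_iff_AE) auto
    then show ?thesis unfolding U_def by (simp add: order_less_le)
  qed
  ultimately show "ereal h \<le> ereal ((LINT x|lebesgue_on \<Omega>. norm (g x) powr p) / (LINT x|lebesgue_on \<Omega>. \<bar>u x\<bar> powr p))"
    by (simp add: U_def I_def field_simps)
qed

section \<open>Radial fields on the ball\<close>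

text \<open>Bridges two measures: the eigenvalue uses completed Lebesgue measure restricted to the
  ball, whereas polar coordinates are stated for \<open>lborel\<close> on the whole space.\<close>

lemma
  fixes g :: "'a::euclidean_space \<Rightarrow> real"
  assumes cont: "continuous_on UNIV g" and zero: "\<And>x. norm x \<ge> \<rho> \<Longrightarrow> g x = 0" and \<rho>: "\<rho> \<le> R"
  shows integrable_lborel_radial_support: "integrable lborel g"
    and integrable_lebesgue_on_radial_support: "integrable (lebesgue_on (ball 0 R)) g"
    and LINT_lebesgue_on_radial_support: "(LINT x|lebesgue_on (ball 0 R). g x) = (LINT x|lborel. g x)"
proof -
  have "integrable lborel (\<lambda>x. indicator (cball 0 \<rho>) x *\<^sub>R g x)"
    by (intro borel_integrable_compact continuous_on_subset[OF cont]) auto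
  also have "(\<lambda>x. indicator (cball 0 \<rho>) x *\<^sub>R g x) = g"
    using zero by (auto simp: indicator_def fun_eq_iff)
  finally show int: "integrable lborel g" .
  have eq: "(\<lambda>x. indicator (ball 0 R) x *\<^sub>R g x) = g"
    using zero \<rho> by (auto simp: indicator_def fun_eq_iff)
  have meas: "g \<in> borel_measurable lborel" using int by simp
  have leb: "integrable lebesgue g" using integrable_completion[OF meas] int by simp
  show "integrable (lebesgue_on (ball 0 R)) g"
    using leb eq by (subst integrable_restrict_space) auto
  show "(LINT x|lebesgue_on (ball 0 R). g x) = (LINT x|lborel. g x)"
    using integral_completion[OF meas] eq by (subst integral_restrict_space) auto
qed

section \<open>Classical regularity and support of test functions\<close>

lemma
  assumes "test_function \<Omega> (\<phi> :: real^'n::finite \<Rightarrow> real)"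
  shows test_function_continuous: "continuous_on UNIV \<phi>"
    and test_function_continuous_grad: "continuous_on UNIV (grad \<phi>)"
    and test_function_has_derivative: "(\<phi> has_derivative (\<lambda>h. grad \<phi> x \<bullet> h)) (at x)"
proof -
  have C: "C_diff 0 \<phi>" "C_diff (Suc 0) \<phi>" using assms by (auto simp only: test_function_def)
  from C(1) show "continuous_on UNIV \<phi>" by simp
  from C(2) have d: "\<phi> differentiable (at x)" for x
    by auto
  from C(2) have c: "continuous_on UNIV (partial_deriv i \<phi>)" for i
    by auto
  show "continuous_on UNIV (grad \<phi>)"
    unfolding grad_def by (intro continuous_on_vec_lambda) (use c in simp)
  have fd: "(\<phi> has_derivative frechet_derivative \<phi> (at x)) (at x)"
    using d frechet_derivative_works by blast
  then have lin: "linear (frechet_derivative \<phi> (at x))"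
    by (rule has_derivative_linear)
  have "frechet_derivative \<phi> (at x) h = grad \<phi> x \<bullet> h" for h
  proof -
    have "frechet_derivative \<phi> (at x) h = frechet_derivative \<phi> (at x) (\<Sum>i\<in>UNIV. h $ i *\<^sub>R axis i 1)"
      by (simp add: basis_expansion flip: scalar_mult_eq_scaleR)
    also have "\<dots> = (\<Sum>i\<in>UNIV. h $ i * frechet_derivative \<phi> (at x) (axis i 1))"
      by (simp add: linear_sum[OF lin] linear_scale[OF lin])
    also have "\<dots> = grad \<phi> x \<bullet> h"
      by (simp add: inner_vec_def grad_def partial_deriv_def mult.commute)
    finally show ?thesis .
  qed
  then show "(\<phi> has_derivative (\<lambda>h. grad \<phi> x \<bullet> h)) (at x)"
    by (intro has_derivative_eq_rhs[OF fd] ext)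
qed

text \<open>The norm attains its maximum on the compact support, hence stays below some
  \<open>m < R\<close>, and \<rho> is taken halfway from max(m, 0) to \<open>R\<close>. The gap to
  \<open>R\<close> matters because the radial fields may blow up at the boundary sphere; the maximum
  with 0 keeps \<rho> positive.\<close>

lemma test_function_ball_support:
  fixes \<phi> :: "real^'n::finite \<Rightarrow> real"
  assumes \<phi>: "test_function (ball 0 R) \<phi>" and R: "R > 0"
  obtains \<rho> where "0 < \<rho>" "\<rho> < R" "\<And>x. norm x \<ge> \<rho> \<Longrightarrow> \<phi> x = 0" "\<And>x. norm x \<ge> \<rho> \<Longrightarrow> grad \<phi> x = 0"
proof -
  define K where "K = closure {x. \<phi> x \<noteq> 0}"
  have K: "compact K" "K \<subseteq> ball 0 R" using \<phi> by (auto simp: K_def test_function_def)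
  have "\<exists>m<R. \<forall>x\<in>K. norm x \<le> m"
  proof (cases "K = {}")
    case True
    then show ?thesis using R by auto
  next
    case False
    have "continuous_on K (norm :: real^'n \<Rightarrow> real)" by (intro continuous_intros)
    from continuous_attains_sup[OF K(1) False this] obtain y where y: "y \<in> K" "\<forall>x\<in>K. norm x \<le> norm y"
      by blast
    moreover have "norm y < R" using K(2) y(1) by auto
    ultimately show ?thesis by blast
  qed
  then obtain m where m: "m < R" "\<And>x. x \<in> K \<Longrightarrow> norm x \<le> m" by blast
  define \<rho> where "\<rho> = (max m 0 + R) / 2"
  have \<rho>: "0 < \<rho>" "\<rho> < R" "m < \<rho>" using R m by (auto simp: \<rho>_def)
  have out: "x \<notin> K" if "norm x \<ge> \<rho>" for x using that m(2)[of x] \<rho> by auto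
  have z: "\<phi> x = 0" if "x \<notin> K" for x
    using that closure_subset[of "{x. \<phi> x \<noteq> 0}"] by (auto simp: K_def)
  have "grad \<phi> x = 0" if x: "x \<notin> K" for x
  proof -
    have "open (- K)" unfolding K_def by (simp add: open_Compl)
    have "(\<phi> has_derivative (\<lambda>_. 0)) (at x)"
      by (rule has_derivative_transform_within_open[OF has_derivative_const[of 0] \<open>open (- K)\<close>])
         (use x z in auto)
    then have "(\<lambda>h. grad \<phi> x \<bullet> h) = (\<lambda>_. 0)"
      using has_derivative_unique test_function_has_derivative[OF \<phi>] by blast
    then have "grad \<phi> x \<bullet> grad \<phi> x = 0" by metis
    then show ?thesis by simp
  qed
  then show thesis using that[OF \<rho>(1,2)] z out by blast
qed

lemma in_Lp_radial_support:
  fixes g :: "real^'n::finite \<Rightarrow> 'b::euclidean_space"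
  assumes p: "p > 1" and cont: "continuous_on UNIV g" and zero: "\<And>x. norm x \<ge> \<rho> \<Longrightarrow> g x = 0" and \<rho>: "\<rho> \<le> R"
  shows "in_Lp p (ball 0 R) g"
proof -
  have "g \<in> borel_measurable borel" using cont by (rule borel_measurable_continuous_onI)
  then have "g \<in> borel_measurable lebesgue"
    by (metis measurable_completion measurable_lborel2)
  then have "g \<in> borel_measurable (lebesgue_on (ball 0 R))"
    by (rule measurable_restrict_space1)
  moreover have "continuous_on UNIV (\<lambda>x. norm (g x) powr p)"
    using p by (auto intro!: continuous_intros continuous_on_powr' cont)
  ultimately show ?thesis unfolding in_Lp_def
    using integrable_lebesgue_on_radial_support[of "\<lambda>x. norm (g x) powr p" \<rho> R] zero \<rho> by auto
qed

text \<open>The inequality is proved on each ray s x with x in the annulus of the polar formula and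
  then integrated over x. Along a ray only the component of the gradient in direction x occurs,
  which Cauchy-Schwarz bounds by the full gradient.\<close>

lemma test_function_rayleigh:
  fixes \<phi> :: "real^'n::finite \<Rightarrow> real" and v v' :: "real \<Rightarrow> real"
  assumes p: "p > 1" and R: "R > 0" and h: "h \<ge> 0" and n: "CARD('n) \<ge> 2"
    and v0: "\<And>r. 0 < r \<Longrightarrow> r < 1 \<Longrightarrow> v r \<ge> 0"
    and v: "\<And>r. 0 < r \<Longrightarrow> r < 1 \<Longrightarrow> (v has_real_derivative v' r) (at r)"
    and ineq: "\<And>r. 0 < r \<Longrightarrow> r < 1 \<Longrightarrow>
       v' r + (real CARD('n) - 1) / r * v r - (p - 1) * v r powr (p / (p - 1)) \<ge> h"
    and \<phi>: "test_function (ball 0 R) \<phi>"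
  shows "h / R powr p * (LINT x|lebesgue_on (ball 0 R). \<bar>\<phi> x\<bar> powr p)
    \<le> (LINT x|lebesgue_on (ball 0 R). norm (grad \<phi> x) powr p)"
proof -
  obtain \<rho> where \<rho>: "0 < \<rho>" "\<rho> < R" "\<And>x. norm x \<ge> \<rho> \<Longrightarrow> \<phi> x = 0" "\<And>x. norm x \<ge> \<rho> \<Longrightarrow> grad \<phi> x = 0"
    by (rule test_function_ball_support[OF \<phi> R]) blast
  define N where "N = CARD('n) - 1"
  have N: "N \<ge> 1" "real N = real CARD('n) - 1" using n by (auto simp: N_def)
  note cont[continuous_intros] = test_function_continuous[OF \<phi>] test_function_continuous_grad[OF \<phi>]
  have cont1: "continuous_on UNIV (\<lambda>x. h / R powr p * \<bar>\<phi> x\<bar> powr p)" 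
    and cont2: "continuous_on UNIV (\<lambda>x. norm (grad \<phi> x) powr p)"
    using p R by (auto intro!: continuous_intros continuous_on_powr')
  have [measurable]: "\<phi> \<in> borel_measurable borel" "grad \<phi> \<in> borel_measurable borel"
    using cont by (auto intro: borel_measurable_continuous_onI)
  have ray: "(\<integral>\<^sup>+s. indicator {0<..} s * (ennreal (s ^ N) * ennreal (h / R powr p * \<bar>\<phi> (s *\<^sub>R x)\<bar> powr p)) \<partial>lborel)
     \<le> (\<integral>\<^sup>+s. indicator {0<..} s * (ennreal (s ^ N) * ennreal (norm (grad \<phi> (s *\<^sub>R x)) powr p)) \<partial>lborel)"
    if x: "1 \<le> norm x" for x
  proof -
    \<comment> \<open>The point s x leaves the ball of radius \<open>R\<close> at s =
      \<open>L\<close> and the ball of radius \<rho> at s = \<open>b\<close>. Since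
      \<open>b < L\<close>, the rescaled variable s/L stays inside (0, 1).\<close>
    define L b where "L = R / norm x" and "b = \<rho> / norm x"
    have x0: "norm x > 0" using x by linarith
    then have L: "L > 0" "0 < b" "b < L" using R \<rho> by (auto simp: L_def b_def divide_strict_right_mono)
    define f f' where "f s = \<phi> (s *\<^sub>R x)" and "f' s = grad \<phi> (s *\<^sub>R x) \<bullet> x" for s
    have contf: "continuous_on A f" "continuous_on A f'" "continuous_on A (\<lambda>s. grad \<phi> (s *\<^sub>R x))" for A
      unfolding f_def f'_def
      by (rule continuous_on_subset[of UNIV], auto intro!: continuous_intros
        continuous_on_compose2[OF cont(1)] continuous_on_compose2[OF cont(2)])+
    have df: "(f has_real_derivative f' s) (at s)" for s
    proof -
      have "((\<lambda>s. s *\<^sub>R x) has_derivative (\<lambda>h. h *\<^sub>R x)) (at s)"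
        by (auto intro!: derivative_eq_intros)
      from has_derivative_compose[OF this test_function_has_derivative[OF \<phi>]]
      have "(f has_derivative (\<lambda>h. grad \<phi> (s *\<^sub>R x) \<bullet> (h *\<^sub>R x))) (at s)"
        unfolding f_def .
      then show ?thesis unfolding has_field_derivative_def f'_def
        by (rule has_derivative_eq_rhs) (auto simp: fun_eq_iff)
    qed
    \<comment> \<open>With the factor L^(1-p), each of the three terms of the differential
      inequality scales by L^(-p); for the last one because (1 - p) p/(p - 1) = -p.\<close>
    define w w' where "w s = L powr (1 - p) * v (s / L)" and "w' s = L powr (1 - p) * (v' (s / L) / L)" for s
    have s01: "0 < s / L" "s / L < 1" if "0 < s" "s \<le> b" for s using that L by auto
    have "integral {0..b} (\<lambda>s. s ^ (CARD('n) - 1) * (h / L powr p * \<bar>f s\<bar> powr p - \<bar>f' s\<bar> powr p)) \<le> 0"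
    proof (rule ray_inequality[OF p \<open>0 < b\<close> _ df contf(2), where v=w and v'=w'])
      show "CARD('n) \<ge> 1" using n by simp
      show "f b = 0" using x0 \<rho> unfolding f_def by (intro \<rho>(3)) (auto simp: b_def)
      fix s assume s: "0 < s" "s \<le> b"
      note s01 = s01[OF s]
      show "w s \<ge> 0" unfolding w_def using v0[OF s01] by simp
      have "((\<lambda>s. s / L) has_real_derivative 1 / L) (at s)"
        using L by (auto intro!: derivative_eq_intros)
      from DERIV_chain2[OF v[OF s01] this]
      show "(w has_real_derivative w' s) (at s)"
        unfolding w_def w'_def by (auto intro!: derivative_eq_intros)
      have Lp: "L powr (1 - p) / L = 1 / L powr p"
        using L by (simp add: powr_diff)
      have "w s powr (p / (p - 1)) = L powr (- p) * v (s / L) powr (p / (p - 1))"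
      proof -
        have "(1 - p) * (p / (p - 1)) = - p" using p by (simp add: field_simps)
        then show ?thesis unfolding w_def using v0[OF s01] L by (simp add: powr_mult powr_powr)
      qed
      also have "L powr (- p) = 1 / L powr p" using L by (simp add: powr_minus divide_inverse)
      finally have wp: "w s powr (p / (p - 1)) = 1 / L powr p * v (s / L) powr (p / (p - 1))" .
      have "real (CARD('n) - 1) / s * w s = (L powr (1 - p) / L) * ((real CARD('n) - 1) / (s / L) * v (s / L))"
        unfolding w_def using L n by (simp add: of_nat_diff)
      then have e: "real (CARD('n) - 1) / s * w s = 1 / L powr p * ((real CARD('n) - 1) / (s / L) * v (s / L))"
        unfolding Lp .
      have e2: "w' s = 1 / L powr p * v' (s / L)"
        unfolding w'_def Lp[symmetric] by simp
      have "1 / L powr p * h \<le> 1 / L powr p * (v' (s / L) + (real CARD('n) - 1) / (s / L) * v (s / L) - (p - 1) * v (s / L) powr (p / (p - 1)))"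
        by (intro mult_left_mono ineq s01) auto
      also have "\<dots> = w' s + real (CARD('n) - 1) / s * w s - (p - 1) * w s powr (p / (p - 1))"
        unfolding e e2 wp by (simp only: algebra_simps)
      finally show "h / L powr p \<le> w' s + real (CARD('n) - 1) / s * w s - (p - 1) * w s powr (p / (p - 1))"
        by simp
    qed
    then have I0: "integral {0..b} (\<lambda>s. s ^ N * (h / L powr p * \<bar>f s\<bar> powr p - \<bar>f' s\<bar> powr p)) \<le> 0"
      by (simp add: N_def)
    define g1 g2 where "g1 s = s ^ N * (h / R powr p * \<bar>f s\<bar> powr p)"
      and "g2 s = s ^ N * (norm (grad \<phi> (s *\<^sub>R x)) powr p)" for s
    \<comment> \<open>The factor |x|^p produced by L = R/|x| is the same one that Cauchy-Schwarz
      produces in the bound for |f'|^p, so it cancels.\<close>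
    have Lp: "h / L powr p = h / R powr p * norm x powr p"
      unfolding L_def using R x0 by (simp add: powr_divide)
    have cg: "continuous_on {0..b} g1" "continuous_on {0..b} g2"
      unfolding g1_def g2_def using p R by (auto intro!: continuous_intros continuous_on_powr' contf)
    have "integral {0..b} (\<lambda>s. norm x powr p * (g1 s - g2 s)) \<le>
        integral {0..b} (\<lambda>s. s ^ N * (h / L powr p * \<bar>f s\<bar> powr p - \<bar>f' s\<bar> powr p))"
    proof (rule integral_le)
      show "(\<lambda>s. norm x powr p * (g1 s - g2 s)) integrable_on {0..b}"
        by (intro integrable_continuous_interval continuous_intros cg)
      show "(\<lambda>s. s ^ N * (h / L powr p * \<bar>f s\<bar> powr p - \<bar>f' s\<bar> powr p)) integrable_on {0..b}"
        using p L by (intro integrable_continuous_interval) (auto intro!: continuous_intros continuous_on_powr' contf)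
      fix s assume s: "s \<in> {0..b}"
      have "\<bar>f' s\<bar> powr p \<le> (norm (grad \<phi> (s *\<^sub>R x)) * norm x) powr p"
        unfolding f'_def using p by (intro powr_mono2 Cauchy_Schwarz_ineq2) auto
      also have "\<dots> = norm x powr p * norm (grad \<phi> (s *\<^sub>R x)) powr p"
        by (simp add: powr_mult mult.commute)
      finally have "s ^ N * (norm x powr p * (h / R powr p * \<bar>f s\<bar> powr p - norm (grad \<phi> (s *\<^sub>R x)) powr p))
          \<le> s ^ N * (h / L powr p * \<bar>f s\<bar> powr p - \<bar>f' s\<bar> powr p)"
        unfolding Lp using s by (intro mult_left_mono) (auto simp: algebra_simps)
      then show "norm x powr p * (g1 s - g2 s) \<le> s ^ N * (h / L powr p * \<bar>f s\<bar> powr p - \<bar>f' s\<bar> powr p)"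
        unfolding g1_def g2_def by (simp add: algebra_simps)
    qed
    also note I0
    finally have "norm x powr p * integral {0..b} (\<lambda>s. g1 s - g2 s) \<le> 0"
      by simp
    then have "integral {0..b} (\<lambda>s. g1 s - g2 s) \<le> 0"
      using x0 by (simp add: mult_le_0_iff)
    then have le: "integral {0..b} g1 \<le> integral {0..b} g2"
      by (subst (asm) Henstock_Kurzweil_Integration.integral_diff)
         (auto intro!: integrable_continuous_interval cg)
    \<comment> \<open>Converts the integral over [0, b] into the nonnegative integral over (0,
      infinity) of the polar formula. The endpoint 0 contributes nothing because \<open>N\<close> is
      at least 1.\<close>
    have nn: "(\<integral>\<^sup>+s. indicator {0<..} s * (ennreal (s ^ N) * ennreal (k s)) \<partial>lborel) = ennreal (integral {0..b} (\<lambda>s. s ^ N * k s))"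
      if k0: "\<And>s. k s \<ge> 0" and kc: "continuous_on {0..b} (\<lambda>s. s ^ N * k s)" and kz: "\<And>s. s > b \<Longrightarrow> k s = 0" for k :: "real \<Rightarrow> real"
    proof -
      have "(\<integral>\<^sup>+s. indicator {0<..} s * (ennreal (s ^ N) * ennreal (k s)) \<partial>lborel) =
        (\<integral>\<^sup>+s. ennreal (s ^ N * k s) * indicator {0..b} s \<partial>lborel)"
        by (intro nn_integral_cong) (use N k0 kz in \<open>auto simp: indicator_def ennreal_mult not_less order_le_less\<close>)
      also have "\<dots> = ennreal (integral {0..b} (\<lambda>s. s ^ N * k s))"
        by (intro nn_integral_has_integral_lebesgue' integrable_integral integrable_continuous_interval kc)
           (auto simp: k0)
      finally show ?thesis .
    qed
    have out: "norm (s *\<^sub>R x) \<ge> \<rho>" if "s > b" for s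
    proof -
      have "s > 0" using that L(2) by linarith
      moreover have "s * norm x > \<rho>" using that x0 by (simp add: b_def field_simps)
      ultimately show ?thesis by simp
    qed
    have "(\<integral>\<^sup>+s. indicator {0<..} s * (ennreal (s ^ N) * ennreal (h / R powr p * \<bar>\<phi> (s *\<^sub>R x)\<bar> powr p)) \<partial>lborel)
        = ennreal (integral {0..b} g1)"
      unfolding g1_def f_def
      by (rule nn) (use cg(1)[unfolded g1_def f_def] \<rho>(3) out h p in auto)
    moreover have "(\<integral>\<^sup>+s. indicator {0<..} s * (ennreal (s ^ N) * ennreal (norm (grad \<phi> (s *\<^sub>R x)) powr p)) \<partial>lborel)
        = ennreal (integral {0..b} g2)"
      unfolding g2_def
      by (rule nn) (use cg(2)[unfolded g2_def] \<rho>(4) out p in auto)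
    ultimately show ?thesis using le by (simp add: ennreal_leI)
  qed
  have "(\<integral>\<^sup>+x. ennreal (h / R powr p * \<bar>\<phi> x\<bar> powr p) \<partial>lborel) \<le> (\<integral>\<^sup>+x. ennreal (norm (grad \<phi> x) powr p) \<partial>lborel)"
    unfolding N_def
    by (subst (1 2) nn_integral_polar, measurable, intro nn_integral_mono)
       (use ray in \<open>auto simp: N_def split: split_indicator\<close>)
  moreover have "integrable lborel (\<lambda>x. h / R powr p * \<bar>\<phi> x\<bar> powr p)"
      "integrable lborel (\<lambda>x. norm (grad \<phi> x) powr p)"
    by (intro integrable_lborel_radial_support[OF cont1, of \<rho>] integrable_lborel_radial_support[OF cont2, of \<rho>];
        use \<rho> in auto)+
  ultimately have "(LINT x|lborel. h / R powr p * \<bar>\<phi> x\<bar> powr p) \<le> (LINT x|lborel. norm (grad \<phi> x) powr p)"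
    using h by (subst (asm) (1 2) nn_integral_eq_integral) auto
  then have "(LINT x|lebesgue_on (ball 0 R). h / R powr p * \<bar>\<phi> x\<bar> powr p) \<le> (LINT x|lebesgue_on (ball 0 R). norm (grad \<phi> x) powr p)"
    using LINT_lebesgue_on_radial_support[OF cont1, of \<rho> R] LINT_lebesgue_on_radial_support[OF cont2, of \<rho> R] \<rho> by auto
  then show ?thesis by simp
qed

lemma lambda1_ball_ge:
  fixes v v' :: "real \<Rightarrow> real"
  assumes p: "p > 1" and R: "R > 0" and h: "h \<ge> 0" and n: "CARD('n::finite) \<ge> 2"
    and "\<And>r. 0 < r \<Longrightarrow> r < 1 \<Longrightarrow> v r \<ge> 0"
    and "\<And>r. 0 < r \<Longrightarrow> r < 1 \<Longrightarrow> (v has_real_derivative v' r) (at r)"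
    and "\<And>r. 0 < r \<Longrightarrow> r < 1 \<Longrightarrow>
       v' r + (real CARD('n) - 1) / r * v r - (p - 1) * v r powr (p / (p - 1)) \<ge> h"
  shows "ereal (h / R powr p) \<le> lambda1 p (ball (0 :: real^'n) R)"
proof (rule lambda1_ge[OF p])
  show "h / R powr p \<ge> 0" using h by simp
  fix \<phi> :: "real^'n \<Rightarrow> real" assume \<phi>: "test_function (ball 0 R) \<phi>"
  obtain \<rho> where \<rho>: "0 < \<rho>" "\<rho> < R" "\<And>x. norm x \<ge> \<rho> \<Longrightarrow> \<phi> x = 0" "\<And>x. norm x \<ge> \<rho> \<Longrightarrow> grad \<phi> x = 0"
    by (rule test_function_ball_support[OF \<phi> R]) blast
  then show "in_Lp p (ball 0 R) \<phi> \<and> in_Lp p (ball 0 R) (grad \<phi>)"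
    using in_Lp_radial_support[OF p test_function_continuous[OF \<phi>], of \<rho> R]
      in_Lp_radial_support[OF p test_function_continuous_grad[OF \<phi>], of \<rho> R] by auto
  show "h / R powr p * (LINT x|lebesgue_on (ball 0 R). \<bar>\<phi> x\<bar> powr p)
      \<le> (LINT x|lebesgue_on (ball 0 R). norm (grad \<phi> x) powr p)"
    by (rule test_function_rayleigh[OF p R h n assms(5-7) \<phi>])
qed

section \<open>Minimization of the explicit profiles\<close>

text \<open>The derivative has the sign of x - z, so \<open>G\<close> decreases up to z and
  increases afterwards; no second derivative has to be examined.\<close>

lemma minimum_of_derivative_sign:
  fixes G k :: "real \<Rightarrow> real"
  assumes S: "is_interval S" "z \<in> S" "t \<in> S"
    and d: "\<And>x. x \<in> S \<Longrightarrow> (G has_real_derivative (x - z) * k x) (at x)"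
    and k: "\<And>x. x \<in> S \<Longrightarrow> k x \<ge> 0"
  shows "G z \<le> G t"
proof (cases "z \<le> t")
  case True
  show ?thesis
  proof (rule DERIV_nonneg_imp_nondecreasing[OF True])
    fix x assume x: "z \<le> x" "x \<le> t"
    then have "x \<in> S" using S mem_is_interval_1_I by blast
    then show "\<exists>y. (G has_real_derivative y) (at x) \<and> 0 \<le> y"
      using d k x by (intro exI[of _ "(x - z) * k x"]) auto
  qed
next
  case False
  show ?thesis
  proof (rule DERIV_nonpos_imp_nonincreasing[of t z])
    fix x assume x: "t \<le> x" "x \<le> z"
    then have "x \<in> S" using S mem_is_interval_1_I by blast
    then show "\<exists>y. (G has_real_derivative y) (at x) \<and> y \<le> 0"
      using d k x by (intro exI[of _ "(x - z) * k x"]) (auto simp: mult_nonpos_nonneg)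
  qed (use False in simp)
qed

lemma affine_pos:
  fixes a b t :: real
  assumes "b > 0" "a + b > 0" "0 < t" "t < 1"
  shows "a * t + b > 0"
proof -
  have "a * t + b = (1 - t) * b + t * (a + b)" by (simp add: algebra_simps)
  then show ?thesis using assms by (simp add: add_pos_pos)
qed

text \<open>The logarithmic derivative of the profile is a quadratic \<open>Q\<close> over a
  positive denominator. Since \<open>Q\<close> vanishes at z and its other linear factor is positive
  on (0, 1), z is the only critical point there and a minimum.\<close>

lemma power_profile_minimum:
  fixes p c a b z t :: real
  assumes p: "p > 0" and c: "c > 0" and b: "b > 0" and ab: "a + b > 0"
    and z: "0 < z" "z < 1" and t: "0 < t" "t < 1"
    and root: "p * z * (a * z + b) - c * (1 - z) * (a * z + b) + a * z * (1 - z) = 0"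
  shows "z powr (- c) * (1 - z) powr (- p) * (a * z + b) \<le> t powr (- c) * (1 - t) powr (- p) * (a * t + b)"
proof -
  define \<alpha> where "\<alpha> = p * a + c * a - a"
  define Q where "Q x = p * x * (a * x + b) - c * (1 - x) * (a * x + b) + a * x * (1 - x)" for x
  define k where "k x = (\<alpha> * x + c * b / z) / (x * (1 - x) * (a * x + b))" for x
  define G where "G x = - c * ln x - p * ln (1 - x) + ln (a * x + b)" for x
  \<comment> \<open>The root z is divided out: \<alpha> is the leading coefficient of
    \<open>Q\<close>, and the constant term - c b fixes the constant of the cofactor as c b / z. The
    combination \<open>z * Q x - x * Q z\<close> eliminates the linear coefficient.\<close>
  have Q: "Q x = (x - z) * (\<alpha> * x + c * b / z)" for x
  proof -
    have "z * Q x = z * Q x - x * Q z" using root by (simp add: Q_def)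
    also have "\<dots> = z * ((x - z) * (\<alpha> * x + c * b / z))"
      using z by (simp add: Q_def \<alpha>_def field_simps power2_eq_square)
    finally show ?thesis using z by simp
  qed
  \<comment> \<open>The cofactor is affine and positive at 0; its sign at 1 is read off from Q(1) =
    p(a + b) > 0.\<close>
  have "\<alpha> + c * b / z > 0"
  proof -
    have "Q 1 = p * (a + b)" by (simp add: Q_def)
    then have "(1 - z) * (\<alpha> + c * b / z) > 0" using Q[of 1] p ab by simp
    then show ?thesis using z by (simp add: zero_less_mult_iff)
  qed
  then have pos: "\<alpha> * x + c * b / z > 0" if "0 < x" "x < 1" for x
    using that b c z by (intro affine_pos) auto
  have "G z \<le> G t"
  proof (rule minimum_of_derivative_sign[of "{0<..<1}" z t G k])
    fix x :: real assume x: "x \<in> {0<..<1}"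
    have l: "a * x + b > 0" using affine_pos[OF b ab] x by auto
    then show "k x \<ge> 0" unfolding k_def using x pos[of x] by simp
    have "(G has_real_derivative - c / x + p / (1 - x) + a / (a * x + b)) (at x)"
      unfolding G_def using x l by (auto intro!: derivative_eq_intros simp: field_simps)
    also have "- c / x + p / (1 - x) + a / (a * x + b) = Q x / (x * (1 - x) * (a * x + b))"
      using x l by (simp add: Q_def divide_simps) (simp add: algebra_simps)
    also have "\<dots> = (x - z) * k x" by (simp add: Q k_def)
    finally show "(G has_real_derivative (x - z) * k x) (at x)" .
  qed (use z t in auto)
  moreover have "x powr (- c) * (1 - x) powr (- p) * (a * x + b) = exp (G x)" if "0 < x" "x < 1" for x
    using that affine_pos[OF b ab that] by (simp add: G_def powr_def exp_add exp_diff exp_minus field_simps)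
  ultimately show ?thesis using z t by simp
qed

text \<open>The same argument on the half-line (0, infinity), where the cofactor p m x + p e / z has
  positive coefficients.\<close>

lemma exponential_profile_minimum:
  fixes p e m z t :: real
  assumes p: "p > 0" and e: "e > 0" and m: "m > 0" and z: "z > 0" and t: "t > 0"
    and root: "p * (z - 1) * (e + m * z) + m * z = 0"
  shows "exp (p * z) * z powr (- p) * (e + m * z) \<le> exp (p * t) * t powr (- p) * (e + m * t)"
proof -
  define Q where "Q x = p * (x - 1) * (e + m * x) + m * x" for x
  define k where "k x = (p * m * x + p * e / z) / (x * (e + m * x))" for x
  define G where "G x = p * x - p * ln x + ln (e + m * x)" for x
  have Q: "Q x = (x - z) * (p * m * x + p * e / z)" for x
  proof -
    have "z * Q x = z * Q x - x * Q z" using root by (simp add: Q_def)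
    also have "\<dots> = z * ((x - z) * (p * m * x + p * e / z))"
      using z by (simp add: Q_def field_simps power2_eq_square)
    finally show ?thesis using z by simp
  qed
  have "G z \<le> G t"
  proof (rule minimum_of_derivative_sign[of "{0<..}" z t G k])
    fix x :: real assume x: "x \<in> {0<..}"
    then have l: "e + m * x > 0" using e m by (auto intro: add_pos_pos)
    then show "k x \<ge> 0" unfolding k_def using x p e m z by simp
    have "(G has_real_derivative p - p / x + m / (e + m * x)) (at x)"
      unfolding G_def using x l by (auto intro!: derivative_eq_intros simp: field_simps)
    also have "p - p / x + m / (e + m * x) = Q x / (x * (e + m * x))"
      using x l by (simp add: Q_def divide_simps) (simp add: algebra_simps)
    also have "\<dots> = (x - z) * k x" by (simp add: Q k_def)
    finally show "(G has_real_derivative (x - z) * k x) (at x)" .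
  qed (use z t in auto)
  moreover have "exp (p * x) * x powr (- p) * (e + m * x) = exp (G x)" if "0 < x" for x
  proof -
    have "e + m * x > 0" using that e m by (auto intro: add_pos_pos)
    then show ?thesis using that by (simp add: G_def powr_def exp_add exp_diff exp_minus field_simps)
  qed
  ultimately show ?thesis using z t by simp
qed

section \<open>The explicit radial fields\<close>

lemma powr_conjugate_exponent:
  fixes v p :: real
  assumes "p > 1" "v \<ge> 0"
  shows "v powr (p / (p - 1)) = v * v powr (1 / (p - 1))"
proof -
  have "p / (p - 1) = 1 + 1 / (p - 1)" using assms by (simp add: field_simps)
  then show ?thesis using assms by (simp add: powr_add)
qed

text \<open>The cases \<open>\<delta> < p\<close> and \<open>\<delta> > p\<close> correspond to \<open>j = 1\<close> and \<open>j = 0\<close>; in both the profile is a function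
  of \<open>t = r\<^sup>m\<close>, where \<open>t\<close> is the variable \<open>z\<close> or \<open>y\<close> of the paper.\<close>

lemma lambda1_ball_ge_power_profile:
  fixes p R m \<sigma> \<kappa> c a b z :: real and j :: nat
  assumes p: "p > 1" and R: "R > 0" and n: "CARD('n::finite) \<ge> 2" and m: "m > 0"
    and \<kappa>: "p * \<kappa> = m * (p - 1)" and \<sigma>: "\<sigma> = (p - 1) * (m * real j - 1)" and c: "m * c = 1 - \<sigma>" "c > 0"
    and ab: "\<And>t. p * (1 - t) * (real CARD('n) - 1 + \<sigma>) + p\<^sup>2 * \<kappa> * t - p * (p - 1) * \<kappa> * t ^ j = a * t + b"
    and b: "b > 0" and abpos: "a + b > 0" and z: "0 < z" "z < 1"
    and root: "p * z * (a * z + b) - c * (1 - z) * (a * z + b) + a * z * (1 - z) = 0"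
  shows "ereal (\<kappa> powr (p - 1) / p * (z powr (- c) * (1 - z) powr (- p) * (a * z + b)) / R powr p)
    \<le> lambda1 p (ball (0 :: real^'n) R)"
proof -
  have \<kappa>0: "\<kappa> > 0" using \<kappa> m p by (metis diff_gt_0_iff_gt less_trans mult_pos_pos zero_less_mult_pos zero_less_one)
  \<comment> \<open>For \<open>j = 1\<close> this is the field of w = (1 - r^m)^((p-1)/p), for
    \<open>j = 0\<close> that of w = (r^(-m) - 1)^((p-1)/p), where factoring out r^(-m) gives
    \<sigma> = 1 - p. The form of \<open>v'\<close> comes from the logarithmic derivative and p
    \<kappa> = m(p - 1).\<close>
  define v where "v r = \<kappa> powr (p - 1) * (r powr \<sigma> * (1 - r powr m) powr (1 - p))" for r
  define v' where "v' r = v r / r * (\<sigma> + p * \<kappa> * (r powr m / (1 - r powr m)))" for r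
  have t01: "0 < r powr m" "r powr m < 1" if "0 < r" "r < 1" for r
    using that m powr_less_mono2[of m r 1] by auto
  show ?thesis
  proof (rule lambda1_ball_ge[OF p R _ n, of _ v v'])
    show "0 \<le> \<kappa> powr (p - 1) / p * (z powr (- c) * (1 - z) powr (- p) * (a * z + b))"
      using p affine_pos[OF b abpos z] by simp
    fix r :: real assume r: "0 < r" "r < 1"
    define t where "t = r powr m"
    have t: "0 < t" "t < 1" using t01[OF r] by (auto simp: t_def)
    show v0: "v r \<ge> 0" by (simp add: v_def)
    have "((\<lambda>r. 1 - r powr m) has_real_derivative - (m * r powr (m - 1))) (at r)"
      using r by (auto intro!: derivative_eq_intros)
    from DERIV_fun_powr[OF this, of "1 - p"] t
    have D1: "((\<lambda>r. (1 - r powr m) powr (1 - p)) has_real_derivative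
       (p - 1) * (1 - t) powr (- p) * (m * (t / r))) (at r)"
      using r by (simp add: t_def powr_diff algebra_simps)
    have D2: "((\<lambda>r. r powr \<sigma>) has_real_derivative \<sigma> * (r powr \<sigma> / r)) (at r)"
      using has_real_derivative_powr[OF r(1), of \<sigma>] r by (simp add: powr_diff)
    have "(v has_real_derivative \<kappa> powr (p - 1) *
      (\<sigma> * (r powr \<sigma> / r) * (1 - r powr m) powr (1 - p) + (p - 1) * (1 - t) powr (- p) * (m * (t / r)) * r powr \<sigma>)) (at r)"
      unfolding v_def by (intro DERIV_cmult DERIV_mult D1 D2)
    also have "\<kappa> powr (p - 1) *
      (\<sigma> * (r powr \<sigma> / r) * (1 - r powr m) powr (1 - p) + (p - 1) * (1 - t) powr (- p) * (m * (t / r)) * r powr \<sigma>) = v' r"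
    proof -
      have "(1 - t) powr (1 - p) = (1 - t) * (1 - t) powr (- p)" using t by (simp add: powr_diff powr_minus_divide)
      then show ?thesis unfolding v'_def v_def t_def[symmetric] \<kappa> using r t
        by (simp only:) (simp add: field_simps)
    qed
    finally show "(v has_real_derivative v' r) (at r)" .
    \<comment> \<open>The conjugate power of v is v times this root, which is rational in t and r;
      hence v/r factors out of the whole expression.\<close>
    have "v r powr (1 / (p - 1)) = \<kappa> * (r powr (\<sigma> / (p - 1)) * (1 - t) powr ((1 - p) / (p - 1)))"
      unfolding v_def t_def[symmetric] using \<kappa>0 r t p by (simp add: powr_mult powr_powr)
    also have "(1 - p) / (p - 1) = - 1" using p by (simp add: field_simps)
    also have "\<sigma> / (p - 1) = m * real j - 1" using p by (simp add: \<sigma>)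
    also have "r powr (m * real j - 1) = t ^ j / r"
      using r t by (simp add: t_def powr_diff powr_powr[symmetric] powr_realpow)
    finally have "v r powr (1 / (p - 1)) = \<kappa> * (t ^ j / r / (1 - t))"
      using t by (simp add: powr_minus_divide)
    then have vp: "v r powr (p / (p - 1)) = v r / r * (\<kappa> * t ^ j / (1 - t))"
      using powr_conjugate_exponent[OF p v0] by simp
    have "v' r + (real CARD('n) - 1) / r * v r - (p - 1) * v r powr (p / (p - 1)) =
      v r / r * ((real CARD('n) - 1 + \<sigma>) + p * \<kappa> * (t / (1 - t)) - (p - 1) * (\<kappa> * t ^ j / (1 - t)))"
    proof -
      have "K * (\<sigma> + q * X) + M / r * v r - (p - 1) * (K * Y) = K * ((M + \<sigma>) + q * X - (p - 1) * Y)"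
        if "K = v r / r" for K M q X Y
        unfolding that using r by (simp add: field_simps)
      then show ?thesis unfolding vp v'_def t_def[symmetric] by blast
    qed
    \<comment> \<open>Hypothesis \<open>ab\<close> states exactly that the numerator over the common
      denominator p(1 - t) is affine in t, also for \<open>j = 0\<close>.\<close>
    also have "(real CARD('n) - 1 + \<sigma>) + p * \<kappa> * (t / (1 - t)) - (p - 1) * (\<kappa> * t ^ j / (1 - t)) = (a * t + b) / (p * (1 - t))"
      unfolding ab[of t, symmetric] using t p by (simp add: divide_simps) (simp add: algebra_simps power2_eq_square)
    also have "v r / r = \<kappa> powr (p - 1) * t powr (- c) * (1 - t) powr (1 - p)"
    proof -
      have "t powr (- c) = r powr (\<sigma> - 1)" using c by (simp add: t_def powr_powr)
      also have "\<dots> = r powr \<sigma> / r" using r by (subst powr_diff) simp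
      finally show ?thesis by (simp add: v_def t_def)
    qed
    also have "\<kappa> powr (p - 1) * t powr (- c) * (1 - t) powr (1 - p) * ((a * t + b) / (p * (1 - t))) =
        \<kappa> powr (p - 1) / p * (t powr (- c) * (1 - t) powr (- p) * (a * t + b))"
      using t by (simp add: powr_diff powr_minus_divide)
    finally have e: "v' r + (real CARD('n) - 1) / r * v r - (p - 1) * v r powr (p / (p - 1)) =
       \<kappa> powr (p - 1) / p * (t powr (- c) * (1 - t) powr (- p) * (a * t + b))" .
    show "\<kappa> powr (p - 1) / p * (z powr (- c) * (1 - z) powr (- p) * (a * z + b)) \<le>
      v' r + (real CARD('n) - 1) / r * v r - (p - 1) * v r powr (p / (p - 1))"
      unfolding e using p by (intro mult_left_mono power_profile_minimum b abpos z t root c) auto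
  qed
qed

text \<open>The borderline \<delta> = p, with w = (- ln r)^((p-1)/p). The variable is t = - ln r in
  (0, infinity), so powers of r become exponentials of t.\<close>

lemma lambda1_ball_ge_log_profile:
  fixes p R \<kappa> z :: real
  assumes p: "p > 1" and R: "R > 0" and n: "CARD('n::finite) \<ge> 2" and pn: "p < real CARD('n)"
    and \<kappa>: "p * \<kappa> = p - 1" and z: "0 < z"
    and root: "p * (z - 1) * (\<kappa> + (real CARD('n) - p) * z) + (real CARD('n) - p) * z = 0"
  shows "ereal (\<kappa> powr (p - 1) * (exp (p * z) * z powr (- p) * (\<kappa> + (real CARD('n) - p) * z)) / R powr p)
    \<le> lambda1 p (ball (0 :: real^'n) R)"
proof -
  define m where "m = real CARD('n) - p"
  have m: "m > 0" using pn by (simp add: m_def)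
  have \<kappa>0: "\<kappa> > 0" using \<kappa> p by (metis diff_gt_0_iff_gt less_trans zero_less_mult_pos zero_less_one)
  define v where "v r = \<kappa> powr (p - 1) * (r powr (1 - p) * (- ln r) powr (1 - p))" for r
  define v' where "v' r = v r / r * ((1 - p) + (p - 1) / (- ln r))" for r
  show ?thesis
  proof (rule lambda1_ball_ge[OF p R _ n, of _ v v'])
    show "0 \<le> \<kappa> powr (p - 1) * (exp (p * z) * z powr (- p) * (\<kappa> + (real CARD('n) - p) * z))"
      using \<kappa>0 pn z by simp
    fix r :: real assume r: "0 < r" "r < 1"
    define t where "t = - ln r"
    have t: "0 < t" using r by (auto simp: t_def)
    have rt: "r = exp (- t)" using r by (simp add: t_def)
    show v0: "v r \<ge> 0" by (simp add: v_def)
    have "((\<lambda>r. - ln r) has_real_derivative - (1 / r)) (at r)"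
      using r by (auto intro!: derivative_eq_intros simp: field_simps)
    from DERIV_fun_powr[OF this, of "1 - p"] t
    have D1: "((\<lambda>r. (- ln r) powr (1 - p)) has_real_derivative
       (p - 1) * t powr (- p) / r) (at r)"
      using r by (simp add: t_def[symmetric] powr_diff algebra_simps divide_simps)
    have D2: "((\<lambda>r. r powr (1 - p)) has_real_derivative (1 - p) * (r powr (1 - p) / r)) (at r)"
    proof -
      have "r powr (1 - p - 1) = r powr (1 - p) / r" using r by (subst powr_diff) simp
      then show ?thesis using has_real_derivative_powr[OF r(1), of "1 - p"] by simp
    qed
    have "(v has_real_derivative \<kappa> powr (p - 1) *
      ((1 - p) * (r powr (1 - p) / r) * (- ln r) powr (1 - p) + (p - 1) * t powr (- p) / r * r powr (1 - p))) (at r)"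
      unfolding v_def by (intro DERIV_cmult DERIV_mult D1 D2)
    also have "\<kappa> powr (p - 1) *
      ((1 - p) * (r powr (1 - p) / r) * (- ln r) powr (1 - p) + (p - 1) * t powr (- p) / r * r powr (1 - p)) = v' r"
    proof -
      have "t powr (1 - p) = t * t powr (- p)" using t by (simp add: powr_diff powr_minus_divide)
      then show ?thesis unfolding v'_def v_def t_def[symmetric] using r t by (simp add: field_simps)
    qed
    finally show "(v has_real_derivative v' r) (at r)" .
    have "v r powr (1 / (p - 1)) = \<kappa> * (r powr ((1 - p) / (p - 1)) * t powr ((1 - p) / (p - 1)))"
      unfolding v_def t_def[symmetric] using \<kappa>0 r t p by (simp add: powr_mult powr_powr)
    also have "(1 - p) / (p - 1) = - 1" using p by (simp add: field_simps)
    finally have "v r powr (1 / (p - 1)) = \<kappa> / (r * t)"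
      using r t by (simp add: powr_minus_divide)
    then have vp: "v r powr (p / (p - 1)) = v r / r * (\<kappa> / t)"
      using powr_conjugate_exponent[OF p v0] by simp
    have "v' r + (real CARD('n) - 1) / r * v r - (p - 1) * v r powr (p / (p - 1)) =
      v r / r * (m + ((p - 1) - (p - 1) * \<kappa>) / t)"
    proof -
      have "(real CARD('n) - 1) / r * v r = v r / r * (m + p - 1)" by (simp add: m_def)
      moreover have "K * ((1 - p) + (p - 1) / t) + K * (m + p - 1) - (p - 1) * (K * (\<kappa> / t)) =
          K * (m + ((p - 1) - (p - 1) * \<kappa>) / t)" for K
        using t by (simp add: field_simps)
      ultimately show ?thesis unfolding vp v'_def t_def[symmetric] by metis
    qed
    also have "(p - 1) - (p - 1) * \<kappa> = \<kappa>" using \<kappa> by (simp add: algebra_simps)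
    also have "v r / r = \<kappa> powr (p - 1) * (exp (p * t) * t powr (1 - p))"
    proof -
      have "r powr (1 - p) / r = exp (p * t)"
        unfolding rt by (simp add: powr_def exp_diff[symmetric] algebra_simps)
      moreover have "v r / r = \<kappa> powr (p - 1) * (r powr (1 - p) / r * t powr (1 - p))"
        by (simp add: v_def t_def)
      ultimately show ?thesis by metis
    qed
    also have "\<kappa> powr (p - 1) * (exp (p * t) * t powr (1 - p)) * (m + \<kappa> / t) =
        \<kappa> powr (p - 1) * (exp (p * t) * t powr (- p) * (\<kappa> + m * t))"
    proof -
      have "t powr (1 - p) = t powr (- p) * t" using t by (simp add: powr_diff powr_minus_divide)
      moreover have "t * (m + \<kappa> / t) = \<kappa> + m * t" using t by (simp add: field_simps)
      ultimately show ?thesis by (simp only: mult.assoc)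
    qed
    finally have e: "v' r + (real CARD('n) - 1) / r * v r - (p - 1) * v r powr (p / (p - 1)) =
       \<kappa> powr (p - 1) * (exp (p * t) * t powr (- p) * (\<kappa> + m * t))" .
    show "\<kappa> powr (p - 1) * (exp (p * z) * z powr (- p) * (\<kappa> + (real CARD('n) - p) * z)) \<le>
      v' r + (real CARD('n) - 1) / r * v r - (p - 1) * v r powr (p / (p - 1))"
      unfolding e m_def[symmetric] using p
      by (intro mult_left_mono exponential_profile_minimum \<kappa>0 m z t root[folded m_def]) auto
  qed
qed

text \<open>The polynomial is negative at 0 and positive at 1. That the given formula picks the root
  in between, whatever the sign of \<open>A\<close>, shows after rationalizing it to x = -2C/(B +
  s), with s the root of the discriminant.\<close>

lemma quadratic_root_in_unit_interval:
  fixes A B C :: real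
  assumes "A \<noteq> 0" "C < 0" "A + B + C > 0"
  defines "x \<equiv> (- B + sqrt (B\<^sup>2 - 4 * A * C)) / (2 * A)"
  shows "0 < x" "x < 1" "A * x\<^sup>2 + B * x + C = 0"
proof -
  \<comment> \<open>The discriminant exceeds (2C + B)^2 by -4C(A + B + C) > 0. So s > |2C + B|,
    which gives B + s > -2C > 0, that is, 0 < x < 1.\<close>
  define s where "s = sqrt (B\<^sup>2 - 4 * A * C)"
  have "B\<^sup>2 - 4 * A * C - (2 * C + B)\<^sup>2 = - 4 * C * (A + B + C)"
    by (simp add: power2_eq_square algebra_simps)
  also have "\<dots> > 0" using assms(2,3) by (simp add: mult_pos_neg mult_neg_pos)
  finally have D: "(2 * C + B)\<^sup>2 < B\<^sup>2 - 4 * A * C" by simp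
  then have s2: "s\<^sup>2 = B\<^sup>2 - 4 * A * C"
    unfolding s_def by (intro real_sqrt_pow2) (smt (verit) zero_le_power2)
  have "\<bar>2 * C + B\<bar> < s"
    unfolding s_def using real_sqrt_less_mono[OF D] by simp
  then have s: "B + s > - 2 * C" "B + s > 0" using assms(2) by auto
  have "(- B + s) * (B + s) = - 4 * A * C"
    using s2 by (simp add: algebra_simps power2_eq_square)
  then have x: "x = - 2 * C / (B + s)"
    unfolding x_def s_def[symmetric] using s(2) assms(1) by (simp add: divide_simps)
  show "0 < x" "x < 1" unfolding x using s assms(2) by (auto simp: divide_simps)
  have "2 * A * x + B = s" unfolding x_def s_def using assms(1) by simp
  then have "(2 * A * x + B)\<^sup>2 = B\<^sup>2 - 4 * A * C" using s2 by simp
  then have "4 * A * (A * x\<^sup>2 + B * x + C) = 0" by (simp add: power2_eq_square algebra_simps)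
  then show "A * x\<^sup>2 + B * x + C = 0" using assms(1) by simp
qed

section \<open>The three cases of the bound\<close>

lemma powr_divide_mult:
  fixes k x y q :: real
  assumes "k \<ge> 0" "x \<ge> 0" "y \<ge> 0"
  shows "(k / (x * y)) powr q = k powr q * (x powr (- q) * y powr (- q))"
  using assms by (simp add: powr_divide powr_mult powr_minus_divide)

text \<open>The power profile with \<open>j = 1\<close>, \<sigma> = 1 - \<delta>. The root lies in
  (0, 1) because C < 0 and A + B + C = (p - \<delta>)^2.\<close>

lemma lambda1_ball_ge_H_less:
  fixes p R \<delta> :: real
  assumes n: "CARD('n::finite) \<ge> 2" and p: "p > 1" and R: "R > 0"
    and \<delta>: "0 < \<delta>" "\<delta> < real CARD('n)" "\<delta> \<noteq> p * ((real CARD('n) - 1) / (p - 1))" and less: "\<delta> < p"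
  shows "ereal (H_fun p (real CARD('n)) \<delta> / R powr p) \<le> lambda1 p (ball (0 :: real^'n) R)"
proof -
  define N where "N = real CARD('n)"
  define A B C z where "A = A_coeff p N \<delta>" "B = B_coeff p N \<delta>" "C = C_coeff p N \<delta>" "z = z_plus p N \<delta>"
  note coeffs = A_B_C_z_def(1-3) A_coeff_def B_coeff_def C_coeff_def
  \<comment> \<open>\<open>a\<close> and \<open>b\<close> are the coefficients in t of the affine
    numerator for \<open>j = 1\<close>, and \<open>c\<close> is \<delta>/m.\<close>
  define a b m \<kappa> c where "a = p - \<delta> - p * (N - \<delta>)" "b = p * (N - \<delta>)"
    "m = (p - \<delta>) / (p - 1)" "\<kappa> = (p - \<delta>) / p" "c = \<delta> * (p - 1) / (p - \<delta>)"
  note defs = a_b_m_\<kappa>_c_def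
  \<comment> \<open>The value of \<delta> excluded from the parameter set is the one with a = 0,
    where \<open>A\<close> vanishes and the formula for \<open>z_plus\<close> would divide by
    zero.\<close>
  have "a \<noteq> 0"
  proof
    assume "a = 0"
    then have "\<delta> * (p - 1) = p * (N - 1)" by (simp add: defs algebra_simps)
    then show False using \<delta>(3) p by (simp add: N_def field_simps)
  qed
  then have "A \<noteq> 0" using p by (simp add: coeffs defs)
  moreover have "C < 0"
    using mult_pos_pos[OF mult_pos_pos[of \<delta> "N - \<delta>"], of "p - 1"] \<delta> p by (simp add: coeffs N_def)
  moreover have "A + B + C = (p - \<delta>)\<^sup>2"
    by (simp add: coeffs power2_eq_square algebra_simps)
  moreover have "z = (- B + sqrt (B\<^sup>2 - 4 * A * C)) / (2 * A)"
    by (simp add: A_B_C_z_def z_plus_def D_coeff_def)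
  ultimately have z: "0 < z" "z < 1" "A * z\<^sup>2 + B * z + C = 0"
    using quadratic_root_in_unit_interval[of A C B] less by auto
  \<comment> \<open>Clearing the denominator of \<open>c\<close> turns the critical point equation
    into p times the quadratic with coefficients A, B, C.\<close>
  have "(p - \<delta>) * (p * z * (a * z + b) - c * (1 - z) * (a * z + b) + a * z * (1 - z)) =
      (p - \<delta>) * p * z * (a * z + b) - ((p - \<delta>) * c) * (1 - z) * (a * z + b) + (p - \<delta>) * a * z * (1 - z)"
    by (simp add: algebra_simps)
  also have "(p - \<delta>) * c = \<delta> * (p - 1)" using less by (simp add: defs)
  also have "(p - \<delta>) * p * z * (a * z + b) - \<delta> * (p - 1) * (1 - z) * (a * z + b) + (p - \<delta>) * a * z * (1 - z)
      = p * (A * z\<^sup>2 + B * z + C)"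
    by (simp add: coeffs defs power2_eq_square algebra_simps)
  finally have root: "p * z * (a * z + b) - c * (1 - z) * (a * z + b) + a * z * (1 - z) = 0"
    using z less by simp
  have "H_fun p N \<delta> = \<kappa> powr (p - 1) / p * (z powr (- c) * (1 - z) powr (- p) * (a * z + b))"
  proof -
    have "H_fun p N \<delta> = ((p - \<delta>) / (p * (1 - z) * z powr (\<delta> / (p - \<delta>)))) powr (p - 1) *
         ((p - \<delta>) * z / (p * (1 - z)) + N - \<delta>)"
      using less by (simp add: H_fun_def Let_def A_B_C_z_def)
    also have "(p - \<delta>) / (p * (1 - z) * z powr (\<delta> / (p - \<delta>))) = \<kappa> / ((1 - z) * z powr (\<delta> / (p - \<delta>)))"
      by (simp add: defs)
    also have "\<dots> powr (p - 1) = \<kappa> powr (p - 1) * ((1 - z) powr (1 - p) * z powr (- c))"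
    proof -
      have "\<delta> / (p - \<delta>) * - (p - 1) = - c" by (simp only: defs mult_minus_right times_divide_eq_left)
      moreover have "\<kappa> \<ge> 0" using less p by (simp add: defs)
      ultimately show ?thesis using z by (subst powr_divide_mult) (auto simp: powr_powr simp del: mult_minus_right)
    qed
    also have "(p - \<delta>) * z / (p * (1 - z)) + N - \<delta> = (a * z + b) / (p * (1 - z))"
      using z p by (simp add: defs divide_simps) (simp add: algebra_simps)
    finally show ?thesis using z by (simp add: powr_diff powr_minus_divide)
  qed
  moreover have "ereal (\<kappa> powr (p - 1) / p * (z powr (- c) * (1 - z) powr (- p) * (a * z + b)) / R powr p)
    \<le> lambda1 p (ball (0 :: real^'n) R)"
  proof (rule lambda1_ball_ge_power_profile[OF p R n, where j=1 and m=m and \<sigma>="1 - \<delta>"])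
    show "p * (1 - t) * (real CARD('n) - 1 + (1 - \<delta>)) + p\<^sup>2 * \<kappa> * t - p * (p - 1) * \<kappa> * t ^ 1 = a * t + b" for t
      using p by (simp add: defs N_def power2_eq_square field_simps)
    show "a + b > 0" using less by (simp add: defs)
    show "m * c = 1 - (1 - \<delta>)" using less p by (simp add: defs)
  qed (use p less \<delta> z root in \<open>auto simp: defs N_def field_simps\<close>)
  ultimately show ?thesis by (simp add: N_def)
qed

text \<open>For \<delta> > p the exponent k is negative, so the variable in (0, 1) is the reciprocal
  of r^k. This reverses the quadratic: \<open>A\<close> and \<open>C\<close> exchange roles, and y
  is a root of C y^2 + B y + A, with A and C both negative.\<close>

lemma lambda1_ball_ge_H_greater:
  fixes p R \<delta> :: real
  assumes n: "CARD('n::finite) \<ge> 2" and p: "p > 1" and R: "R > 0"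
    and \<delta>: "\<delta> < real CARD('n)" and greater: "p < \<delta>"
  shows "ereal (H_fun p (real CARD('n)) \<delta> / R powr p) \<le> lambda1 p (ball (0 :: real^'n) R)"
proof -
  define N where "N = real CARD('n)"
  define A B C z where "A = A_coeff p N \<delta>" "B = B_coeff p N \<delta>" "C = C_coeff p N \<delta>" "z = y_plus p N \<delta>"
  note coeffs = A_B_C_z_def(1-3) A_coeff_def B_coeff_def C_coeff_def
  define a b m \<kappa> c where "a = - (p * (N - \<delta>))" "b = \<delta> - p + p * (N - \<delta>)"
    "m = (\<delta> - p) / (p - 1)" "\<kappa> = (\<delta> - p) / p" "c = p * (p - 1) / (\<delta> - p)"
  note defs = a_b_m_\<kappa>_c_def
  have N\<delta>: "N - \<delta> > 0" using \<delta> by (simp add: N_def)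
  have "p - \<delta> - p * (N - \<delta>) < 0"
    using greater p mult_pos_pos[OF _ N\<delta>, of p] by linarith
  then have "A < 0" "C < 0"
    using N\<delta> greater p by (auto simp: coeffs mult_pos_neg mult_neg_pos)
  moreover have "A + B + C = (p - \<delta>)\<^sup>2"
    by (simp add: coeffs power2_eq_square algebra_simps)
  moreover have "z = (- B + sqrt (B\<^sup>2 - 4 * C * A)) / (2 * C)"
    by (simp add: A_B_C_z_def y_plus_def D_coeff_def mult.commute mult.left_commute)
  ultimately have z: "0 < z" "z < 1" "C * z\<^sup>2 + B * z + A = 0"
    using quadratic_root_in_unit_interval[of C A B] greater by (auto simp: add.commute add.left_commute)
  have "(\<delta> - p) * (p * z * (a * z + b) - c * (1 - z) * (a * z + b) + a * z * (1 - z)) =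
      (\<delta> - p) * p * z * (a * z + b) - ((\<delta> - p) * c) * (1 - z) * (a * z + b) + (\<delta> - p) * a * z * (1 - z)"
    by (simp add: algebra_simps)
  also have "(\<delta> - p) * c = p * (p - 1)" using greater by (simp add: defs)
  also have "(\<delta> - p) * p * z * (a * z + b) - p * (p - 1) * (1 - z) * (a * z + b) + (\<delta> - p) * a * z * (1 - z)
      = p * (C * z\<^sup>2 + B * z + A)"
    by (simp add: coeffs defs power2_eq_square algebra_simps)
  finally have root: "p * z * (a * z + b) - c * (1 - z) * (a * z + b) + a * z * (1 - z) = 0"
    using z greater by simp
  have "H_fun p N \<delta> = \<kappa> powr (p - 1) / p * (z powr (- c) * (1 - z) powr (- p) * (a * z + b))"
  proof -
    have "H_fun p N \<delta> = ((\<delta> - p) / (p * (1 - z) * z powr (p / (\<delta> - p)))) powr (p - 1) *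
         ((\<delta> - p) / (p * (1 - z)) + N - \<delta>)"
      using greater by (simp add: H_fun_def Let_def A_B_C_z_def)
    also have "(\<delta> - p) / (p * (1 - z) * z powr (p / (\<delta> - p))) = \<kappa> / ((1 - z) * z powr (p / (\<delta> - p)))"
      by (simp add: defs)
    also have "\<dots> powr (p - 1) = \<kappa> powr (p - 1) * ((1 - z) powr (1 - p) * z powr (- c))"
    proof -
      have "p / (\<delta> - p) * - (p - 1) = - c" by (simp only: defs mult_minus_right times_divide_eq_left)
      moreover have "\<kappa> \<ge> 0" using greater p by (simp add: defs)
      ultimately show ?thesis using z by (subst powr_divide_mult) (auto simp: powr_powr simp del: mult_minus_right)
    qed
    also have "(\<delta> - p) / (p * (1 - z)) + N - \<delta> = (a * z + b) / (p * (1 - z))"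
      using z p by (simp add: defs divide_simps) (simp add: algebra_simps)
    finally show ?thesis using z by (simp add: powr_diff powr_minus_divide)
  qed
  moreover have "ereal (\<kappa> powr (p - 1) / p * (z powr (- c) * (1 - z) powr (- p) * (a * z + b)) / R powr p)
    \<le> lambda1 p (ball (0 :: real^'n) R)"
  proof (rule lambda1_ball_ge_power_profile[OF p R n, where j=0 and m=m and \<sigma>="1 - p"])
    show "p * (1 - t) * (real CARD('n) - 1 + (1 - p)) + p\<^sup>2 * \<kappa> * t - p * (p - 1) * \<kappa> * t ^ 0 = a * t + b" for t
      using p by (simp add: defs N_def power2_eq_square field_simps)
    show "b > 0" unfolding defs using greater p N\<delta> by (intro add_pos_pos mult_pos_pos) auto
    show "a + b > 0" using greater by (simp add: defs)
    show "m * c = 1 - (1 - p)" using greater p by (simp add: defs)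
  qed (use p greater z root in \<open>auto simp: defs field_simps\<close>)
  ultimately show ?thesis by (simp add: N_def)
qed

text \<open>Since A < 0 < C, the two roots have opposite signs, and with A negative the minus sign
  before the square root selects the positive one.\<close>

lemma lambda1_ball_ge_H_equal:
  fixes p R :: real
  assumes n: "CARD('n::finite) \<ge> 2" and p: "p > 1" and R: "R > 0" and pn: "p < real CARD('n)"
  shows "ereal (H_fun p (real CARD('n)) p / R powr p) \<le> lambda1 p (ball (0 :: real^'n) R)"
proof -
  define N \<kappa> where "N = real CARD('n)" "\<kappa> = (p - 1) / p"
  define A B C z where "A = A0_coeff p N" "B = B0_coeff p N" "C = C0_coeff p N" "z = z0_minus p N"
  note coeffs = A_B_C_z_def(1-3) A0_coeff_def B0_coeff_def C0_coeff_def
  define s where "s = sqrt (B\<^sup>2 - 4 * A * C)"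
  have AC: "A < 0" "C > 0" using p pn by (auto simp: coeffs N_\<kappa>_def mult_neg_pos)
  have D: "B\<^sup>2 < B\<^sup>2 - 4 * A * C" using mult_neg_pos[OF AC] by simp
  then have s2: "s\<^sup>2 = B\<^sup>2 - 4 * A * C"
    unfolding s_def by (intro real_sqrt_pow2) (smt (verit) zero_le_power2)
  have "\<bar>B\<bar> < s"
    unfolding s_def using real_sqrt_less_mono[OF D] by simp
  moreover have zs: "z = (- B - s) / (2 * A)"
    by (simp add: A_B_C_z_def s_def z0_minus_def D0_coeff_def)
  ultimately have z: "z > 0" using AC by (simp add: divide_neg_neg)
  have "2 * A * z + B = - s" using AC by (simp add: zs)
  then have "(2 * A * z + B)\<^sup>2 = B\<^sup>2 - 4 * A * C" using s2 by simp
  then have "4 * A * (A * z\<^sup>2 + B * z + C) = 0" by (simp add: power2_eq_square algebra_simps)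
  then have "A * z\<^sup>2 + B * z + C = 0" using AC by simp
  moreover have "p * (p * (z - 1) * (\<kappa> + (N - p) * z) + (N - p) * z) = - (A * z\<^sup>2 + B * z + C)"
    using p by (simp add: coeffs N_\<kappa>_def power2_eq_square field_simps)
  ultimately have root: "p * (z - 1) * (\<kappa> + (N - p) * z) + (N - p) * z = 0" using p by simp
  have "H_fun p N p = \<kappa> powr (p - 1) * (exp (p * z) * z powr (- p) * (\<kappa> + (N - p) * z))"
  proof -
    have "H_fun p N p = ((p - 1) / (p * exp (- z) * z)) powr (p - 1) *
         ((p - 1) / (p * exp (- z) * z) + (N - p) / exp (- z))"
      by (simp add: H_fun_def Let_def A_B_C_z_def)
    also have "(p - 1) / (p * exp (- z) * z) = \<kappa> / (exp (- z) * z)"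
      by (simp add: N_\<kappa>_def)
    also have "(\<kappa> / (exp (- z) * z)) powr (p - 1) = \<kappa> powr (p - 1) * (exp ((p - 1) * z) * z powr (1 - p))"
    proof -
      have "exp (- z) powr (- (p - 1)) = exp ((p - 1) * z)"
        by (simp add: exp_powr_real algebra_simps)
      moreover have "\<kappa> \<ge> 0" using p by (simp add: N_\<kappa>_def)
      ultimately show ?thesis using z by (subst powr_divide_mult) auto
    qed
    also have "\<kappa> / (exp (- z) * z) + (N - p) / exp (- z) = exp z * (\<kappa> + (N - p) * z) / z"
      using z by (simp add: exp_minus field_simps)
    also have "\<kappa> powr (p - 1) * (exp ((p - 1) * z) * z powr (1 - p)) * (exp z * (\<kappa> + (N - p) * z) / z) =
       \<kappa> powr (p - 1) * ((exp ((p - 1) * z) * exp z) * (z powr (1 - p) / z) * (\<kappa> + (N - p) * z))"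
      by simp
    also have "exp ((p - 1) * z) * exp z = exp (p * z)" by (simp add: algebra_simps flip: exp_add)
    also have "z powr (1 - p) / z = z powr (- p)" using z by (simp add: powr_diff powr_minus_divide)
    finally show ?thesis .
  qed
  then show ?thesis
    using lambda1_ball_ge_log_profile[OF p R n pn, of \<kappa> z] z root p by (simp add: N_\<kappa>_def)
qed

section \<open>The supremum over the parameter\<close>

theorem theorem6p4:
  fixes p R :: real
  assumes "CARD('n::finite) \<ge> 2" and "p > 1" and "R > 0"
  shows "lambda1 p (ball (0 :: real^'n) R) \<ge> Lambda3 p (real CARD('n)) R"
proof -
  let ?N = "real CARD('n)"
  \<comment> \<open>A nonempty parameter set lets the factor 1/R^p move inside the supremum. The
    parameter 1 belongs to it because p(n - 1) >= p > p - 1 for n >= 2.\<close>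
  have "1 \<in> Sigma_set p ?N"
  proof -
    have "p - 1 < p * (?N - 1)"
    proof -
      have "p * 2 \<le> p * ?N" using assms by (intro mult_left_mono) auto
      then show ?thesis by (simp add: algebra_simps)
    qed
    then have "1 < p * ((?N - 1) / (p - 1))" using assms(2) by (simp add: field_simps)
    then have "1 \<noteq> p * ((?N - 1) / (p - 1))" by (rule less_imp_neq)
    moreover have "1 < ?N" using assms(1) by simp
    ultimately show ?thesis unfolding Sigma_set_def by (simp only: mem_Collect_eq zero_less_one simp_thms)
  qed
  then have "Lambda3 p ?N R = (SUP \<delta>\<in>Sigma_set p ?N. ereal (1 / R powr p) * ereal (H_fun p ?N \<delta>))"
    unfolding Lambda3_def by (intro Sup_ereal_mult_left') auto
  also have "\<dots> \<le> lambda1 p (ball (0 :: real^'n) R)"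
  proof (rule SUP_least)
    fix \<delta> assume "\<delta> \<in> Sigma_set p ?N"
    then have \<delta>: "0 < \<delta>" "\<delta> < ?N" "\<delta> \<noteq> p * ((?N - 1) / (p - 1))" by (auto simp: Sigma_set_def)
    have "ereal (H_fun p ?N \<delta> / R powr p) \<le> lambda1 p (ball (0 :: real^'n) R)"
      using lambda1_ball_ge_H_less[OF assms \<delta>] lambda1_ball_ge_H_equal[OF assms]
        lambda1_ball_ge_H_greater[OF assms \<delta>(2)] \<delta>(2)
      by (cases \<delta> p rule: linorder_cases) auto
    then show "ereal (1 / R powr p) * ereal (H_fun p ?N \<delta>) \<le> lambda1 p (ball (0 :: real^'n) R)"
      by simp
  qed
  finally show ?thesis .
qed

end
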